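(* Let $f:\mathbb{E}\to\mathbb{R}$ be convex and $p$-times differentiable, $p\ge2$, with a minimizer $x^*$, and let $\nu\in[0,1]$ satisfy $H_{f,p}(\nu)<+\infty$. Let $\{x_t\}_{t=0}^T$ and $\{z_t\}_{t=0}^T$ be generated by Algorithm 2 (described in the context). Assume that, for $t=0,\ldots,T$, $$\min\left\{\|\nabla f(x_{t,i}^+)\|_*,\|\nabla f(z_{t,j}^+)\|_*\right\}>\epsilon,\qquad i=0,\ldots,i_t,\ j=0,\ldots,j_t.$$ If $T=2s$ for some integer $s>1$, then $$g_T^*\equiv\min_{0\le t\le T}\|\nabla f(z_t)\|_*\le C_\nu(\epsilon)\,\|x_0-x^*\|^{p+\alpha-1}\left[\frac{p+1}{T-2}\right]^{\frac{(p+\alpha-1)(p+\alpha+1)}{p+\alpha}},$$ where $$C_\nu(\epsilon)=\left[2^{4p+6}\max\{\tilde H_0,\tilde N_\nu(\epsilon)\}\max\{H_0,N_\nu(\epsilon)\}^{\frac{1}{p+\alpha-1}}\right]^{\frac{p+\alpha-1}{p+\alpha}}.$$ Consequently, if $\nu$ is known (i.e., $\alpha=\nu$), $$T\le2+2^{4p+6}(p+1)\max\left\{1,\tilde H_0,H_0,3p\left(H_{f,p}(\nu)+\theta(p-1)!\right)\right\}\|x_0-x^*\|^{\frac{p+\nu}{p+\nu+1}}\epsilon^{-\frac{p+\nu}{(p+\nu-1)(p+\nu+1)}},$$ and, if $\nu$ is unknown (i.e., $\alpha=1$), $$T<2+2^{2p+3}(p+1)\max\left\{1,\tilde H_0,H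_0,4\left[(4H_{f,p}(\nu))^{\frac{p}{p+\nu-1}}+\theta(p-1)!\right]\right\}^{\frac12}\|x_0-x^*\|^{\frac{p+1}{p+2}}\epsilon^{-\frac{p+1}{(p+\nu-1)(p+2)}}.$$
   Context: **Notation.** $\mathbb{E}$ is a finite-dimensional real vector space with dual $\mathbb{E}^*$, $\langle s,x\rangle$ is the value of $s\in\mathbb{E}^*$ at $x$, $B:\mathbb{E}\to\mathbb{E}^*$ is a fixed self-adjoint positive definite operator, $\|x\|=\langle Bx,x\rangle^{1/2}$ and $\|s\|_*=\langle s,B^{-1}s\rangle^{1/2}$. $D^if(x)[h]^i$ is the $i$th directional derivative of $f$ at $x$ along $h$; the norm of a symmetric $p$-linear form $A$ is $\|A\|=\max\{|A[h_1,\ldots,h_p]|:\|h_i\|\le1\}$. $H_{f,p}(\nu)=\sup_{x\ne y}\|D^pf(x)-D^pf(y)\|/\|x-y\|^\nu$. $\Phi_{x,p}(y)=f(x)+\sum_{i=1}^p\frac{1}{i!}D^if(x)[y-x]^i$ and $\Omega^{(\alpha)}_{x,p,H}(y)=\Phi_{x,p}(y)+\frac{H}{p!}\|y-x\|^{p+\alpha}$, $\alpha\in[0,1]$. Throughout $\alpha=\nu$ if "$\nu$ is known" and $\alpha=1$ if "$\nu$ is unknown". **Algorithm 2.** Step 0: choose $x_0\in\mathbb{E}$, $\tilde H_0,H_0>0$, $\theta\ge0$, $\epsilon\in(0,1)$. Set $\psi_0(x)=\frac{1}{p+\alpha}\|x-x_0\|^{p+\alpha}$, $v_0=z_0=x_0$,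 $A_0=0$, $t:=0$. Step 1: if $\min\{\|\nabla f(x_t)\|_*,\|\nabla f(z_t)\|_*\}\le\epsilon$, stop. Step 2: set $i:=0$. Step 2.1: compute $a_{t,i}>0$ solving $a_{t,i}^{p+\alpha}=\frac{1}{2^{3p-1}}\left[\frac{(p-1)!}{2^i\tilde H_t}\right](A_t+a_{t,i})^{p+\alpha-1}$. Step 2.2: set $\gamma_{t,i}=\frac{a_{t,i}}{A_t+a_{t,i}}$ and $y_{t,i}=(1-\gamma_{t,i})x_t+\gamma_{t,i}v_t$. Step 2.3: compute an approximate solution $x_{t,i}^+$ of $\min_x\Omega^{(\alpha)}_{y_{t,i},p,2^i\tilde H_t}(x)$ with $\Omega^{(\alpha)}_{y_{t,i},p,2^i\tilde H_t}(x_{t,i}^+)\le f(y_{t,i})$ and $\|\nabla\Omega^{(\alpha)}_{y_{t,i},p,2^i\tilde H_t}(x_{t,i}^+)\|_*\le\theta\|x_{t,i}^+-y_{t,i}\|^{p+\alpha-1}$. Step 2.4: if either $\|\nabla f(x_{t,i}^+)\|_*\le\epsilon$ or $$\langle\nabla f(x_{t,i}^+),y_{t,i}-x_{t,i}^+\rangle\ge\frac14\left[\frac{(p-1)!}{2^i\tilde H_t}\right]^{\frac{1}{p+\alpha-1}}\|\nabla f(x_{t,i}^+)\|_*^{\frac{p+\alpha}{p+\alpha-1}},$$ set $i_t:=i$ and go to Step 3; otherwise $i:=i+1$ and go to Step 2.1. Step 3: set $x_{t+1}=x_{t,i_t}^+$, $\tilde H_{t+1}=2^{i_t-1}\tilde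 H_t$, $a_t=a_{t,i_t}$, $A_{t+1}=A_t+a_t$. Step 4: set $\psi_{t+1}(x)=\psi_t(x)+a_t[f(x_{t+1})+\langle\nabla f(x_{t+1}),x-x_{t+1}\rangle]$ and $v_{t+1}=\arg\min_{x\in\mathbb{E}}\psi_{t+1}(x)$. Step 5: set $\bar z_t=\arg\min\{f(y):y\in\{z_t,x_{t+1}\}\}$. Step 6: set $j:=0$. Step 6.1: compute an approximate solution $z_{t,j}^+$ of $\min_y\Omega^{(\alpha)}_{\bar z_t,p,2^jH_t}(y)$ with $\Omega^{(\alpha)}_{\bar z_t,p,2^jH_t}(z_{t,j}^+)\le f(\bar z_t)$ and $\|\nabla\Omega^{(\alpha)}_{\bar z_t,p,2^jH_t}(z_{t,j}^+)\|_*\le\theta\|z_{t,j}^+-\bar z_t\|^{p+\alpha-1}$. Step 6.2: if either $\|\nabla f(z_{t,j}^+)\|_*\le\epsilon$ or $$f(\bar z_t)-f(z_{t,j}^+)\ge\frac{1}{8(p+1)!(2^jH_t)^{\frac{1}{p+\alpha-1}}}\|\nabla f(z_{t,j}^+)\|_*^{\frac{p+\alpha}{p+\alpha-1}},$$ set $j_t:=j$ and go to Step 7; otherwise $j:=j+1$ and go to Step 6.1. Step 7: set $z_{t+1}=z_{t,j_t}^+$, $H_{t+1}=2^{j_t-1}H_t$, $t:=t+1$ and go to Step 1. **Quantities.** $$N_\nu(\epsilon)=\begin{cases}\max\left\{\frac{3H_{f,p}(\nu)}{2},3\theta(p-1)!\right\},&\nu\text{ known},\\\max\left\{\theta,\left(\frac{3H_{f,p}(\nu)}{2}\right)^{\frac{p}{p+\nu-1}}4^{\frac{1-\nu}{p+\nu-1}}\right\}\epsilon^{-\frac{1-\nu}{p+\nu-1}},&\nu\text{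 unknown},\end{cases}$$ $$\tilde N_\nu(\epsilon)=\begin{cases}(p+\nu-1)(H_{f,p}(\nu)+\theta(p-1)!),&\nu\text{ known},\\\max\left\{4\theta(p-1)!,(4H_{f,p}(\nu))^{\frac{p}{p+\nu-1}}\left(\frac4\epsilon\right)^{\frac{1-\nu}{p+\nu-1}}\right\},&\nu\text{ unknown}.\end{cases}$$ *)

theory Defs
  imports "HOL-Analysis.Analysis"
begin

text \<open>
  The ambient space is a type of class \<open>euclidean_space\<close>, but only its vector space structure (and
  the topology, which is independent of the norm) matters: all metric notions come from the
  operator \<open>B\<close> between the space and its dual, the latter being \<open>'a \<Rightarrow>\<^sub>L real\<close>.
\<close>

definition self_adjoint_pos_def :: "('a::euclidean_space \<Rightarrow>\<^sub>L ('a \<Rightarrow>\<^sub>L real)) \<Rightarrow> bool" where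
  "self_adjoint_pos_def B \<longleftrightarrow>
     (\<forall>x y. blinfun_apply (blinfun_apply B x) y = blinfun_apply (blinfun_apply B y) x) \<and>
     (\<forall>x. x \<noteq> 0 \<longrightarrow> blinfun_apply (blinfun_apply B x) x > 0)"

definition Bnorm :: "('a::euclidean_space \<Rightarrow>\<^sub>L ('a \<Rightarrow>\<^sub>L real)) \<Rightarrow> 'a \<Rightarrow> real" where
  "Bnorm B x = sqrt (blinfun_apply (blinfun_apply B x) x)"

definition dual_Bnorm :: "('a::euclidean_space \<Rightarrow>\<^sub>L ('a \<Rightarrow>\<^sub>L real)) \<Rightarrow> ('a \<Rightarrow>\<^sub>L real) \<Rightarrow> real" where
  "dual_Bnorm B s = sqrt (blinfun_apply s (inv (blinfun_apply B) s))"

definition grad :: "('a::euclidean_space \<Rightarrow> real) \<Rightarrow> 'a \<Rightarrow> ('a \<Rightarrow>\<^sub>L real)" where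
  "grad f x = Blinfun (frechet_derivative f (at x))"

text \<open>
  \<open>higher_deriv f [h\<^sub>1, \<dots>, h\<^sub>i] x\<close> is \<open>D\<^sup>i f(x)[h\<^sub>1, \<dots>, h\<^sub>i]\<close>; the order of differentiation is the
  length of the list of directions.
\<close>

fun higher_deriv :: "('a::euclidean_space \<Rightarrow> real) \<Rightarrow> 'a list \<Rightarrow> 'a \<Rightarrow> real" where
  "higher_deriv f [] = f"
| "higher_deriv f (h # hs) = (\<lambda>x. frechet_derivative (higher_deriv f hs) (at x) h)"

text \<open>
  In finite dimension the map \<open>x \<mapsto> D\<^sup>i f(x)\<close> into the \<open>i\<close>-linear forms is Frechet differentiable iff
  all its evaluations \<open>x \<mapsto> D\<^sup>i f(x)[h\<^sub>1, \<dots>, h\<^sub>i]\<close> are.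
\<close>

definition times_differentiable :: "nat \<Rightarrow> ('a::euclidean_space \<Rightarrow> real) \<Rightarrow> bool" where
  "times_differentiable p f \<longleftrightarrow>
     (\<forall>hs x. length hs < p \<longrightarrow> higher_deriv f hs differentiable (at x))"

text \<open>Norm of a \<open>p\<close>-linear form given as a function on lists of length \<open>p\<close>.\<close>

definition form_norm ::
  "('a::euclidean_space \<Rightarrow>\<^sub>L ('a \<Rightarrow>\<^sub>L real)) \<Rightarrow> nat \<Rightarrow> ('a list \<Rightarrow> real) \<Rightarrow> real" where
  "form_norm B p A = Sup {\<bar>A hs\<bar> | hs. length hs = p \<and> (\<forall>h\<in>set hs. Bnorm B h \<le> 1)}"

definition Holder_const ::
  "('a::euclidean_space \<Rightarrow>\<^sub>L ('a \<Rightarrow>\<^sub>L real)) \<Rightarrow> ('a \<Rightarrow> real) \<Rightarrow> nat \<Rightarrow> real \<Rightarrow> ereal" where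
  "Holder_const B f p \<nu> = (SUP (x, y) \<in> {(x, y). x \<noteq> y}.
     ereal (form_norm B p (\<lambda>hs. higher_deriv f hs x - higher_deriv f hs y)
            / Bnorm B (x - y) powr \<nu>))"

definition taylor_model :: "('a::euclidean_space \<Rightarrow> real) \<Rightarrow> nat \<Rightarrow> 'a \<Rightarrow> 'a \<Rightarrow> real" where
  "taylor_model f p x y =
     f x + (\<Sum>i = 1..p. 1 / fact i * higher_deriv f (replicate i (y - x)) x)"

definition regularized_model ::
  "('a::euclidean_space \<Rightarrow>\<^sub>L ('a \<Rightarrow>\<^sub>L real)) \<Rightarrow> ('a \<Rightarrow> real) \<Rightarrow> nat \<Rightarrow> real \<Rightarrow> real \<Rightarrow> 'a \<Rightarrow> 'a \<Rightarrow> real"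
where
  "regularized_model B f p \<alpha> M x y =
     taylor_model f p x y + M / fact p * Bnorm B (y - x) powr (p + \<alpha>)"

text \<open>Inexactness conditions on the approximate minimizer \<open>u\<close> of the model around \<open>y\<close>.\<close>

definition approx_min ::
  "('a::euclidean_space \<Rightarrow>\<^sub>L ('a \<Rightarrow>\<^sub>L real)) \<Rightarrow> ('a \<Rightarrow> real) \<Rightarrow> nat \<Rightarrow> real \<Rightarrow> real \<Rightarrow> real \<Rightarrow> 'a \<Rightarrow> 'a \<Rightarrow> bool"
where
  "approx_min B f p \<alpha> \<theta> M y u \<longleftrightarrow>
     regularized_model B f p \<alpha> M y u \<le> f y \<and>
     dual_Bnorm B (grad (regularized_model B f p \<alpha> M y) u)
       \<le> \<theta> * Bnorm B (u - y) powr (p + \<alpha> - 1)"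

text \<open>Acceptance tests of the two inner loops, with trial regularization parameter \<open>M\<close>.\<close>

definition accept_x ::
  "('a::euclidean_space \<Rightarrow>\<^sub>L ('a \<Rightarrow>\<^sub>L real)) \<Rightarrow> ('a \<Rightarrow> real) \<Rightarrow> nat \<Rightarrow> real \<Rightarrow> real \<Rightarrow> real \<Rightarrow> 'a \<Rightarrow> 'a \<Rightarrow> bool"
where
  "accept_x B f p \<alpha> \<epsilon> M y u \<longleftrightarrow>
     dual_Bnorm B (grad f u) \<le> \<epsilon> \<or>
     blinfun_apply (grad f u) (y - u)
       \<ge> 1 / 4 * (fact (p - 1) / M) powr (1 / (p + \<alpha> - 1))
           * dual_Bnorm B (grad f u) powr ((p + \<alpha>) / (p + \<alpha> - 1))"

definition accept_z ::
  "('a::euclidean_space \<Rightarrow>\<^sub>L ('a \<Rightarrow>\<^sub>L real)) \<Rightarrow> ('a \<Rightarrow> real) \<Rightarrow> nat \<Rightarrow> real \<Rightarrow> real \<Rightarrow> real \<Rightarrow> 'a \<Rightarrow> 'a \<Rightarrow> bool"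
where
  "accept_z B f p \<alpha> \<epsilon> M y u \<longleftrightarrow>
     dual_Bnorm B (grad f u) \<le> \<epsilon> \<or>
     f y - f u
       \<ge> 1 / (8 * fact (p + 1) * M powr (1 / (p + \<alpha> - 1)))
           * dual_Bnorm B (grad f u) powr ((p + \<alpha>) / (p + \<alpha> - 1))"

text \<open>
  All quantities produced by a run. \<open>Ht\<close> and \<open>H\<close> are \<open>H\<close> with and without tilde,
  \<open>zbar\<close> is \<open>z\<close> with a bar, \<open>itx\<close> and \<open>itz\<close> are the accepted inner indices \<open>i\<^sub>t\<close> and \<open>j\<^sub>t\<close>;
  \<open>cand_a\<close>, \<open>\<dots>\<close> carry the two indices \<open>t, i\<close> (or \<open>t, j\<close>), \<open>xplus\<close> and \<open>zplus\<close> being the candidates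
  marked by a plus.
\<close>

record 'a run =
  xs :: "nat \<Rightarrow> 'a"
  zs :: "nat \<Rightarrow> 'a"
  vs :: "nat \<Rightarrow> 'a"
  zbar :: "nat \<Rightarrow> 'a"
  As :: "nat \<Rightarrow> real"
  Ht :: "nat \<Rightarrow> real"
  H :: "nat \<Rightarrow> real"
  psi :: "nat \<Rightarrow> 'a \<Rightarrow> real"
  itx :: "nat \<Rightarrow> nat"
  itz :: "nat \<Rightarrow> nat"
  cand_a :: "nat \<Rightarrow> nat \<Rightarrow> real"
  cand_gamma :: "nat \<Rightarrow> nat \<Rightarrow> real"
  cand_y :: "nat \<Rightarrow> nat \<Rightarrow> 'a"
  xplus :: "nat \<Rightarrow> nat \<Rightarrow> 'a"
  zplus :: "nat \<Rightarrow> nat \<Rightarrow> 'a"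

definition run_init ::
  "('a::euclidean_space \<Rightarrow>\<^sub>L ('a \<Rightarrow>\<^sub>L real)) \<Rightarrow> nat \<Rightarrow> real \<Rightarrow> 'a \<Rightarrow> real \<Rightarrow> real \<Rightarrow> 'a run \<Rightarrow> bool"
where
  "run_init B p \<alpha> x0 Ht0 H0 R \<longleftrightarrow>
     xs R 0 = x0 \<and> vs R 0 = x0 \<and> zs R 0 = x0 \<and> As R 0 = 0 \<and> Ht R 0 = Ht0 \<and> H R 0 = H0 \<and>
     psi R 0 = (\<lambda>x. 1 / (p + \<alpha>) * Bnorm B (x - x0) powr (p + \<alpha>))"

text \<open>
  Iteration \<open>t\<close> is carried out completely: the stopping test fails and the remaining steps
  yield the data with index \<open>t + 1\<close>. The inner loops stop at the first accepted candidate, and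
  only candidates up to that one are constrained.
\<close>

definition run_step ::
  "('a::euclidean_space \<Rightarrow>\<^sub>L ('a \<Rightarrow>\<^sub>L real)) \<Rightarrow> ('a \<Rightarrow> real) \<Rightarrow> nat \<Rightarrow> real \<Rightarrow> real \<Rightarrow> real \<Rightarrow> 'a run \<Rightarrow> nat \<Rightarrow> bool"
where
  "run_step B f p \<alpha> \<theta> \<epsilon> R t \<longleftrightarrow>
     \<not> min (dual_Bnorm B (grad f (xs R t))) (dual_Bnorm B (grad f (zs R t))) \<le> \<epsilon> \<and>
     (\<forall>i \<le> itx R t.
        cand_a R t i > 0 \<and>
        cand_a R t i powr (p + \<alpha>)
          = 1 / 2 ^ (3 * p - 1) * (fact (p - 1) / (2 ^ i * Ht R t))
              * (As R t + cand_a R t i) powr (p + \<alpha> - 1) \<and>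
        cand_gamma R t i = cand_a R t i / (As R t + cand_a R t i) \<and>
        cand_y R t i = (1 - cand_gamma R t i) *\<^sub>R xs R t + cand_gamma R t i *\<^sub>R vs R t \<and>
        approx_min B f p \<alpha> \<theta> (2 ^ i * Ht R t) (cand_y R t i) (xplus R t i)) \<and>
     (\<forall>i < itx R t. \<not> accept_x B f p \<alpha> \<epsilon> (2 ^ i * Ht R t) (cand_y R t i) (xplus R t i)) \<and>
     accept_x B f p \<alpha> \<epsilon> (2 ^ itx R t * Ht R t) (cand_y R t (itx R t)) (xplus R t (itx R t)) \<and>
     xs R (t + 1) = xplus R t (itx R t) \<and>
     Ht R (t + 1) = 2 powi (int (itx R t) - 1) * Ht R t \<and>
     As R (t + 1) = As R t + cand_a R t (itx R t) \<and>
     psi R (t + 1) = (\<lambda>x. psi R t x + cand_a R t (itx R t) *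
       (f (xs R (t + 1)) + blinfun_apply (grad f (xs R (t + 1))) (x - xs R (t + 1)))) \<and>
     is_arg_min (psi R (t + 1)) (\<lambda>_. True) (vs R (t + 1)) \<and>
     is_arg_min f (\<lambda>y. y \<in> {zs R t, xs R (t + 1)}) (zbar R t) \<and>
     (\<forall>j \<le> itz R t. approx_min B f p \<alpha> \<theta> (2 ^ j * H R t) (zbar R t) (zplus R t j)) \<and>
     (\<forall>j < itz R t. \<not> accept_z B f p \<alpha> \<epsilon> (2 ^ j * H R t) (zbar R t) (zplus R t j)) \<and>
     accept_z B f p \<alpha> \<epsilon> (2 ^ itz R t * H R t) (zbar R t) (zplus R t (itz R t)) \<and>
     zs R (t + 1) = zplus R t (itz R t) \<and>
     H R (t + 1) = 2 powi (int (itz R t) - 1) * H R t"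

text \<open>
  In the constants below \<open>L\<close> stands for the (finite) Holder constant, and the flag \<open>known\<close> tells
  whether \<open>\<nu>\<close> is known to the method; it cannot be recovered from the exponent \<open>\<alpha>\<close> when \<open>\<nu> = 1\<close>.
\<close>

definition alpha_exp :: "bool \<Rightarrow> real \<Rightarrow> real" where
  "alpha_exp known \<nu> = (if known then \<nu> else 1)"

definition N_const :: "bool \<Rightarrow> nat \<Rightarrow> real \<Rightarrow> real \<Rightarrow> real \<Rightarrow> real \<Rightarrow> real" where
  "N_const known p \<nu> \<theta> L \<epsilon> =
     (if known then max (3 * L / 2) (3 * \<theta> * fact (p - 1))
      else max \<theta> ((3 * L / 2) powr (p / (p + \<nu> - 1)) * 4 powr ((1 - \<nu>) / (p + \<nu> - 1)))
             * \<epsilon> powr (- ((1 - \<nu>) / (p + \<nu> - 1))))"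

definition Nt_const :: "bool \<Rightarrow> nat \<Rightarrow> real \<Rightarrow> real \<Rightarrow> real \<Rightarrow> real \<Rightarrow> real" where
  "Nt_const known p \<nu> \<theta> L \<epsilon> =
     (if known then (p + \<nu> - 1) * (L + \<theta> * fact (p - 1))
      else max (4 * \<theta> * fact (p - 1))
             ((4 * L) powr (p / (p + \<nu> - 1)) * (4 / \<epsilon>) powr ((1 - \<nu>) / (p + \<nu> - 1))))"

definition C_const :: "bool \<Rightarrow> nat \<Rightarrow> real \<Rightarrow> real \<Rightarrow> real \<Rightarrow> real \<Rightarrow> real \<Rightarrow> real \<Rightarrow> real" where
  "C_const known p \<nu> \<theta> L \<epsilon> Ht0 H0 = (let \<alpha> = alpha_exp known \<nu> in
     (2 ^ (4 * p + 6) * max Ht0 (Nt_const known p \<nu> \<theta> L \<epsilon>)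
        * max H0 (N_const known p \<nu> \<theta> L \<epsilon>) powr (1 / (p + \<alpha> - 1)))
     powr ((p + \<alpha> - 1) / (p + \<alpha>)))"

end

theory Submission
  imports Defs
begin

text \<open>
  Write \<open>q = p + \<alpha> - 1\<close>, let \<open>D\<close> be the distance of \<open>x0\<close> to the minimizer and let \<open>L\<close> be the Holder constant.
  The method runs two coupled sequences: an accelerated one makes the function value small fast, and
  plain regularized Taylor steps from the best known point turn this small value into a small gradient.

  \<^emph>\<open>Acceptance.\<close> Applying the one-dimensional Maclaurin formula to directional derivatives along a
  segment bounds the error of the Taylor model by \<open>L / p! * \<rho> powr (p + \<nu>)\<close> in value and by
  \<open>L / (p-1)! * \<rho> powr (p + \<nu> - 1)\<close> in gradient, \<open>\<rho>\<close> being the length of the step. An approximate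
  minimizer \<open>u\<close> of the model around \<open>y\<close> with regularization \<open>M\<close> therefore has a gradient \<open>g\<close> which
  differs from \<open>- \<kappa> * \<rho> powr (q - 1) * B (u - y)\<close>, \<open>\<kappa> = M (p + \<alpha>) / p!\<close>, by at most
  \<open>e * \<rho> powr q\<close>. If \<open>e\<close> is small compared with \<open>\<kappa>\<close>, squaring this estimate gives the test on
  \<open>\<langle>g, y - u\<rangle>\<close>, and comparing values gives the test on the decrease of \<open>f\<close>. When \<open>\<nu> < \<alpha> = 1\<close> the error
  \<open>e\<close> contains \<open>L * \<rho> powr (\<nu> - 1)\<close>, which is large only for short steps; but a step that short would
  end at a gradient of norm at most \<open>\<epsilon>\<close>. So every candidate with trial parameter at least
  \<open>Nt_const\<close> or \<open>N_const\<close> is accepted (\<open>accept_x_large\<close>, \<open>accept_z_large\<close>), and the doubling in the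
  inner loops cannot raise \<open>Ht\<close> and \<open>H\<close> above the constants \<open>Ht_max\<close> and \<open>H_max\<close> that enter \<open>C_const\<close>.

  \<^emph>\<open>Acceleration.\<close> The functions \<open>psi\<close> form an estimating sequence: \<open>As t * f (x t) \<le> min (psi t)\<close>
  (\<open>estimating_sequence\<close>) while \<open>psi t \<le> As t * f + (norm (\<cdot> - x0)) powr (q + 1) / (q + 1)\<close>
  (\<open>psi_upper\<close>). The equation that defines the step coefficients forces \<open>As t\<close> to grow like
  \<open>t powr (q + 1)\<close> (\<open>As_growth\<close>), hence \<open>f (x t) - min f\<close> decays like \<open>D powr (q + 1) / t powr (q + 1)\<close>
  (\<open>objective_rate\<close>).

  \<^emph>\<open>Gradients.\<close> Let \<open>T = 2 * s\<close>. At time \<open>s\<close> the second sequence starts from a point at least as good as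
  \<open>x (s + 1)\<close>, and each of the remaining \<open>s\<close> steps lowers \<open>f\<close> by a multiple of \<open>g powr ((q + 1) / q)\<close>,
  where \<open>g\<close> is the smallest gradient norm. The total decrease cannot exceed the gap of \<open>x (s + 1)\<close>, so
  \<open>g powr ((q + 1) / q)\<close> decays like \<open>s powr (- (q + 2))\<close> (\<open>gradient_rate\<close>). As \<open>g > \<epsilon>\<close>, solving for
  \<open>T\<close> bounds the number of iterations (\<open>iteration_bound\<close>); the two explicit bounds on \<open>T\<close> only estimate
  \<open>Ht_max\<close> and \<open>H_max\<close> by a common quantity.
\<close>

section \<open>Symmetry of second derivatives\<close>

text \<open>
  By the mean value theorem in direction \<open>u\<close> the second difference equals
  \<open>t (G (x + t v + \<xi> u) - G (x + \<xi> u))\<close> with \<open>G\<close> the derivative of \<open>F\<close> along \<open>u\<close>. Differentiability of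
  \<open>G\<close> at the single point \<open>x\<close> suffices to expand both terms up to \<open>o(t)\<close>, and the terms in \<open>u\<close> cancel.
  This covers the derivative of order \<open>p\<close>, which may be discontinuous when \<open>\<nu> = 0\<close>.
\<close>

lemma second_difference_quotient_tendsto:
  fixes F :: "'a::euclidean_space \<Rightarrow> real"
  assumes F: "\<And>x. F differentiable (at x)"
    and G: "(\<lambda>x. frechet_derivative F (at x) u) differentiable (at x)"
  shows "((\<lambda>t. (F (x + t *\<^sub>R u + t *\<^sub>R v) - F (x + t *\<^sub>R u) - F (x + t *\<^sub>R v) + F x) / t\<^sup>2)
           \<longlongrightarrow> frechet_derivative (\<lambda>x. frechet_derivative F (at x) u) (at x) v) (at_right 0)"
proof -
  define G where "G = (\<lambda>x. frechet_derivative F (at x) u)"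
  define G' where "G' = frechet_derivative G (at x)"
  have Gd: "(G has_derivative G') (at x)"
    using G unfolding G_def G'_def frechet_derivative_works .
  interpret bl: bounded_linear G' using Gd by (rule has_derivative_bounded_linear)
  have Fd: "(F has_derivative frechet_derivative F (at y)) (at y)" for y
    using F frechet_derivative_works by blast
  have Fline: "((\<lambda>s. F (z + s *\<^sub>R u)) has_real_derivative G (z + s *\<^sub>R u)) (at s)" for z s
  proof -
    have lin: "linear (frechet_derivative F (at (z + s *\<^sub>R u)))"
      using F by (rule linear_frechet_derivative)
    have "((\<lambda>s. F (z + s *\<^sub>R u)) has_derivative
            (\<lambda>r. frechet_derivative F (at (z + s *\<^sub>R u)) (r *\<^sub>R u))) (at s)"
      by (rule has_derivative_compose[of "\<lambda>s. z + s *\<^sub>R u", OF _ Fd])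
         (auto intro!: derivative_eq_intros)
    then show ?thesis
      by (simp add: has_field_derivative_def linear_cmul[OF lin] G_def mult.commute[of _ "frechet_derivative F (at (z + s *\<^sub>R u)) u"] cong: if_cong)
  qed
  let ?q = "\<lambda>t. (F (x + t *\<^sub>R u + t *\<^sub>R v) - F (x + t *\<^sub>R u) - F (x + t *\<^sub>R v) + F x) / t\<^sup>2"
  have main: "\<exists>d>0. \<forall>t. 0 < t \<and> t < d \<longrightarrow> \<bar>?q t - G' v\<bar> < e" if "e > 0" for e
  proof -
    define n where "n = norm u + norm v + 1"
    have n: "n > 0" by (simp add: n_def add_nonneg_pos)
    define e' where "e' = e / (4 * n)"
    have e': "e' > 0" using that n by (simp add: e'_def)
    obtain d where d: "d > 0" "\<And>y. norm (y - x) < d \<Longrightarrow> norm (G y - G x - G' (y - x)) \<le> e' * norm (y - x)"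
      using Gd e' unfolding has_derivative_at_alt by blast
    have "\<bar>?q t - G' v\<bar> < e" if t: "0 < t" "t < d / n" for t
    proof -
      let ?\<phi> = "\<lambda>s. F (x + t *\<^sub>R v + s *\<^sub>R u) - F (x + s *\<^sub>R u)"
      obtain \<xi> where \<xi>: "0 < \<xi>" "\<xi> < t"
        "?\<phi> t - ?\<phi> 0 = (t - 0) * (G (x + t *\<^sub>R v + \<xi> *\<^sub>R u) - G (x + \<xi> *\<^sub>R u))"
        using MVT2[OF t(1) DERIV_diff[OF Fline[of "x + t *\<^sub>R v"] Fline[of x]]] by blast
      have q: "?q t = (G (x + t *\<^sub>R v + \<xi> *\<^sub>R u) - G (x + \<xi> *\<^sub>R u)) / t"
      proof -
        have "F (x + t *\<^sub>R u + t *\<^sub>R v) - F (x + t *\<^sub>R u) - F (x + t *\<^sub>R v) + F x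
            = t * (G (x + t *\<^sub>R v + \<xi> *\<^sub>R u) - G (x + \<xi> *\<^sub>R u))"
          using \<xi>(3) by (simp add: add_ac)
        then show ?thesis using t by (simp add: power2_eq_square)
      qed
      have a: "norm (t *\<^sub>R v + \<xi> *\<^sub>R u) \<le> t * n"
      proof -
        have "norm (t *\<^sub>R v + \<xi> *\<^sub>R u) \<le> t * norm v + \<xi> * norm u"
          using norm_triangle_ineq[of "t *\<^sub>R v" "\<xi> *\<^sub>R u"] t \<xi> by simp
        also have "\<dots> \<le> t * norm v + t * norm u" using \<xi> by (simp add: mult_right_mono)
        also have "\<dots> \<le> t * n" using t by (simp add: n_def algebra_simps)
        finally show ?thesis .
      qed
      have b: "norm (\<xi> *\<^sub>R u) \<le> t * n"
      proof -
        have "norm (\<xi> *\<^sub>R u) \<le> t * norm u" using \<xi> by (simp add: mult_right_mono)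
        also have "\<dots> \<le> t * n" using t by (simp add: n_def mult_left_mono)
        finally show ?thesis .
      qed
      have tn: "t * n < d" using t n by (simp add: field_simps)
      have A: "\<bar>G (x + t *\<^sub>R v + \<xi> *\<^sub>R u) - G x - (t * G' v + \<xi> * G' u)\<bar> \<le> e' * (t * n)"
      proof -
        have "x + t *\<^sub>R v + \<xi> *\<^sub>R u - x = t *\<^sub>R v + \<xi> *\<^sub>R u" by simp
        then have "norm (G (x + t *\<^sub>R v + \<xi> *\<^sub>R u) - G x - G' (t *\<^sub>R v + \<xi> *\<^sub>R u)) \<le> e' * norm (t *\<^sub>R v + \<xi> *\<^sub>R u)"
          using d(2)[of "x + t *\<^sub>R v + \<xi> *\<^sub>R u"] a tn by auto
        also have "\<dots> \<le> e' * (t * n)" using a e' by (intro mult_left_mono) auto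
        finally show ?thesis by (simp add: bl.add bl.scaleR)
      qed
      have B: "\<bar>G (x + \<xi> *\<^sub>R u) - G x - \<xi> * G' u\<bar> \<le> e' * (t * n)"
      proof -
        have "norm (G (x + \<xi> *\<^sub>R u) - G x - G' (\<xi> *\<^sub>R u)) \<le> e' * norm (\<xi> *\<^sub>R u)"
          using d(2)[of "x + \<xi> *\<^sub>R u"] b tn by auto
        also have "\<dots> \<le> e' * (t * n)" using b e' by (intro mult_left_mono) auto
        finally show ?thesis by (simp add: bl.scaleR)
      qed
      have "\<bar>(G (x + t *\<^sub>R v + \<xi> *\<^sub>R u) - G (x + \<xi> *\<^sub>R u)) - t * G' v\<bar> \<le> 2 * (e' * (t * n))"
        using A B by linarith
      then have "\<bar>((G (x + t *\<^sub>R v + \<xi> *\<^sub>R u) - G (x + \<xi> *\<^sub>R u)) - t * G' v) / t\<bar> \<le> 2 * (e' * n)"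
        using t unfolding abs_divide by (simp add: divide_le_eq mult_ac)
      moreover have "?q t - G' v = ((G (x + t *\<^sub>R v + \<xi> *\<^sub>R u) - G (x + \<xi> *\<^sub>R u)) - t * G' v) / t"
        unfolding q using t by (simp add: diff_divide_distrib)
      ultimately have "\<bar>?q t - G' v\<bar> \<le> 2 * (e' * n)" by simp
      also have "\<dots> < e" using n \<open>e > 0\<close> by (simp add: e'_def)
      finally show ?thesis .
    qed
    moreover have "d / n > 0" using d n by simp
    ultimately show ?thesis by blast
  qed
  have "(?q \<longlongrightarrow> G' v) (at_right 0)"
    unfolding tendsto_iff dist_real_def
  proof (intro allI impI)
    fix e :: real assume "e > 0"
    from main[OF this] obtain d where "d > 0" "\<And>t. 0 < t \<and> t < d \<Longrightarrow> \<bar>?q t - G' v\<bar> < e" by auto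
    then show "eventually (\<lambda>t. \<bar>?q t - G' v\<bar> < e) (at_right 0)"
      unfolding eventually_at_right_field by auto
  qed
  then show ?thesis by (simp add: G'_def G_def)
qed

text \<open>
  The second difference quotient is symmetric in \<open>u\<close> and \<open>v\<close>, so its limit is as well.
\<close>

lemma second_derivative_symmetric:
  fixes F :: "'a::euclidean_space \<Rightarrow> real"
  assumes F: "\<And>x. F differentiable (at x)"
    and G: "\<And>h x. (\<lambda>x. frechet_derivative F (at x) h) differentiable (at x)"
  shows "frechet_derivative (\<lambda>x. frechet_derivative F (at x) u) (at x) v
       = frechet_derivative (\<lambda>x. frechet_derivative F (at x) v) (at x) u"
proof -
  let ?q = "\<lambda>t. (F (x + t *\<^sub>R u + t *\<^sub>R v) - F (x + t *\<^sub>R u) - F (x + t *\<^sub>R v) + F x) / t\<^sup>2"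
  have "(?q \<longlongrightarrow> frechet_derivative (\<lambda>x. frechet_derivative F (at x) v) (at x) u) (at_right 0)"
  proof (rule Lim_transform_eventually[OF second_difference_quotient_tendsto[OF F G, of x v u]])
    show "\<forall>\<^sub>F t in at_right 0. (F (x + t *\<^sub>R v + t *\<^sub>R u) - F (x + t *\<^sub>R v) - F (x + t *\<^sub>R u) + F x) / t\<^sup>2 = ?q t"
      by (simp add: algebra_simps)
  qed
  then show ?thesis
    by (rule tendsto_unique[OF trivial_limit_at_right_real second_difference_quotient_tendsto[OF F G]])
qed

section \<open>Higher derivatives as symmetric multilinear forms\<close>

definition multilinear_form :: "nat \<Rightarrow> ('a::euclidean_space list \<Rightarrow> real) \<Rightarrow> bool" where
  "multilinear_form n A \<longleftrightarrow>
     (\<forall>us ws. length us + length ws + 1 = n \<longrightarrow> linear (\<lambda>h. A (us @ h # ws)))"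

lemma higher_deriv_differentiable:
  assumes "times_differentiable p f" "length hs < p"
  shows "higher_deriv f hs differentiable (at x)"
  using assms unfolding times_differentiable_def by blast

text \<open>
  The first slot is linear because derivatives are. A later slot is linear because the inner
  derivative depends linearly on it at every point, and differentiation preserves this.
\<close>

lemma higher_deriv_linear_slot:
  assumes f: "times_differentiable p f" and "length us + length ws < p"
  shows "linear (\<lambda>h. higher_deriv f (us @ h # ws) x)"
  using assms(2)
proof (induction us arbitrary: x)
  case Nil
  then have "linear (frechet_derivative (higher_deriv f ws) (at x))"
    by (intro linear_frechet_derivative higher_deriv_differentiable[OF f]) simp
  then show ?case by simp
next
  case (Cons u us)
  let ?G = "\<lambda>h. higher_deriv f (us @ h # ws)"
  have len: "length us + length ws < p" using Cons by simp
  have diff: "?G h differentiable (at x)" for h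
    using Cons.prems by (intro higher_deriv_differentiable[OF f]) simp
  have G: "(?G h has_derivative frechet_derivative (?G h) (at x)) (at x)" for h
    using diff frechet_derivative_works by blast
  have add: "?G (a + b) = (\<lambda>x. ?G a x + ?G b x)" for a b
    using Cons.IH[OF len] by (auto simp: linear_iff)
  have scale: "?G (c *\<^sub>R a) = (\<lambda>x. c * ?G a x)" for a c
    using Cons.IH[OF len] by (auto simp: linear_iff)
  show ?case
  proof (rule linearI)
    fix a b
    have "frechet_derivative (?G (a + b)) (at x) = (\<lambda>u. frechet_derivative (?G a) (at x) u + frechet_derivative (?G b) (at x) u)"
      unfolding add by (rule frechet_derivative_at[symmetric], rule has_derivative_add[OF G G])
    from fun_cong[OF this, of u] show "higher_deriv f ((u # us) @ (a + b) # ws) x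
        = higher_deriv f ((u # us) @ a # ws) x + higher_deriv f ((u # us) @ b # ws) x"
      by simp
  next
    fix c a
    have "frechet_derivative (?G (c *\<^sub>R a)) (at x) = (\<lambda>u. c * frechet_derivative (?G a) (at x) u)"
      unfolding scale by (rule frechet_derivative_at[symmetric], rule has_derivative_mult_right[OF G])
    from fun_cong[OF this, of u] show "higher_deriv f ((u # us) @ (c *\<^sub>R a) # ws) x = c *\<^sub>R higher_deriv f ((u # us) @ a # ws) x"
      by simp
  qed
qed

lemma multilinear_higher_deriv:
  assumes "times_differentiable p f" "n \<le> p"
  shows "multilinear_form n (\<lambda>hs. higher_deriv f hs x)"
  unfolding multilinear_form_def using assms by (auto intro!: higher_deriv_linear_slot)

lemma multilinear_form_diff:
  assumes "multilinear_form n A" "multilinear_form n A'"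
  shows "multilinear_form n (\<lambda>hs. A hs - A' hs)"
  using assms unfolding multilinear_form_def by (auto intro!: linear_compose_sub)

lemma multilinear_form_Cons:
  assumes "multilinear_form (Suc n) A"
  shows "multilinear_form n (\<lambda>hs. A (b # hs))"
  unfolding multilinear_form_def
proof (intro allI impI)
  fix us ws :: "'a list" assume "length us + length ws + 1 = n"
  then have "length (b # us) + length ws + 1 = Suc n" by simp
  then have "linear (\<lambda>h. A ((b # us) @ h # ws))"
    using assms unfolding multilinear_form_def by blast
  then show "linear (\<lambda>h. A (b # us @ h # ws))" by simp
qed

lemma multilinear_form_head:
  assumes "multilinear_form (Suc n) A" "length hs = n"
  shows "linear (\<lambda>h. A (h # hs))"
  using assms(1)[unfolded multilinear_form_def, rule_format, of "[]" hs] assms(2) by simp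

lemma multilinear_form_expand_head:
  assumes "multilinear_form (Suc n) A" "length hs = n"
  shows "A (h # hs) = (\<Sum>b\<in>Basis. (h \<bullet> b) * A (b # hs))"
proof -
  have lin: "linear (\<lambda>h. A (h # hs))" by (rule multilinear_form_head[OF assms])
  have "A (h # hs) = A ((\<Sum>b\<in>Basis. (h \<bullet> b) *\<^sub>R b) # hs)" by (simp add: euclidean_representation)
  also have "\<dots> = (\<Sum>b\<in>Basis. (h \<bullet> b) * A (b # hs))"
    using linear_sum[OF lin, of "\<lambda>b. (h \<bullet> b) *\<^sub>R b" Basis] linear_cmul[OF lin] by simp
  finally show ?thesis .
qed

text \<open>
  Symmetry of second derivatives allows swapping two neighbouring directions; the outer directions
  \<open>us\<close> differentiate both sides of an identity of functions.
\<close>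

lemma higher_deriv_swap:
  assumes f: "times_differentiable p f" and "length us + length ws + 2 \<le> p"
  shows "higher_deriv f (us @ h # k # ws) x = higher_deriv f (us @ k # h # ws) x"
  using assms(2)
proof (induction us arbitrary: x)
  case Nil
  have F: "higher_deriv f ws differentiable (at x)" for x
    using Nil by (intro higher_deriv_differentiable[OF f]) simp
  have G: "(\<lambda>x. frechet_derivative (higher_deriv f ws) (at x) h) differentiable (at x)" for h x
    using higher_deriv_differentiable[OF f, of "h # ws" x] Nil by simp
  show ?case using second_derivative_symmetric[OF F G, of k x h] by simp
next
  case (Cons u us)
  then have "higher_deriv f (us @ h # k # ws) = higher_deriv f (us @ k # h # ws)" by auto
  then show ?case by simp
qed

text \<open>
  The gradient of the Taylor model produces a direction \<open>h\<close> in an arbitrary position, whereas the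
  Taylor expansion of \<open>f'(\<cdot>)[h]\<close> has it innermost, that is, last in the list.
\<close>

lemma higher_deriv_move_last:
  assumes f: "times_differentiable p f" and "k + m + 1 \<le> p"
  shows "higher_deriv f (replicate k z @ h # replicate m z) x = higher_deriv f (replicate (k + m) z @ [h]) x"
  using assms(2)
proof (induction m arbitrary: k)
  case (Suc m)
  have "higher_deriv f (replicate k z @ h # replicate (Suc m) z) x = higher_deriv f (replicate k z @ z # h # replicate m z) x"
    using higher_deriv_swap[OF f, of "replicate k z" "replicate m z" h z x] Suc.prems by simp
  also have "\<dots> = higher_deriv f (replicate (Suc k) z @ h # replicate m z) x"
    by (simp add: replicate_app_Cons_same)
  also have "\<dots> = higher_deriv f (replicate (Suc k + m) z @ [h]) x"
    using Suc.prems by (intro Suc.IH) simp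
  finally show ?case by simp
qed simp

text \<open>
  Induction by the product rule: expanding the first argument in the basis separates it from the
  others.
\<close>

lemma multilinear_form_diagonal_derivative:
  assumes "multilinear_form n A"
  shows "((\<lambda>z. A (replicate n z)) has_derivative
           (\<lambda>h. \<Sum>k<n. A (replicate k z @ h # replicate (n - 1 - k) z))) (at z)"
  using assms
proof (induction n arbitrary: A)
  case 0
  show ?case by (simp add: has_derivative_const)
next
  case (Suc n)
  note [derivative_intros] = Suc.IH[OF multilinear_form_Cons[OF Suc.prems]]
  have "(\<lambda>z. A (replicate (Suc n) z)) = (\<lambda>z. \<Sum>b\<in>Basis. (z \<bullet> b) * A (b # replicate n z))"
    unfolding replicate_Suc by (rule ext, rule multilinear_form_expand_head[OF Suc.prems length_replicate])
  moreover have "((\<lambda>z. \<Sum>b\<in>Basis. (z \<bullet> b) * A (b # replicate n z)) has_derivative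
     (\<lambda>h. \<Sum>b\<in>Basis. (z \<bullet> b) * (\<Sum>k<n. A (b # replicate k z @ h # replicate (n - 1 - k) z))
            + (h \<bullet> b) * A (b # replicate n z))) (at z)"
    by (auto intro!: derivative_eq_intros)
  moreover have "(\<Sum>b\<in>Basis. (z \<bullet> b) * (\<Sum>k<n. A (b # replicate k z @ h # replicate (n - 1 - k) z))
            + (h \<bullet> b) * A (b # replicate n z))
      = (\<Sum>k<Suc n. A (replicate k z @ h # replicate (Suc n - 1 - k) z))" for h
  proof -
    have e: "(\<Sum>b\<in>Basis. (z \<bullet> b) * A (b # replicate k z @ h # replicate (n - 1 - k) z))
       = A (z # replicate k z @ h # replicate (n - 1 - k) z)" if "k < n" for k
      using multilinear_form_expand_head[OF Suc.prems, of "replicate k z @ h # replicate (n - 1 - k) z" z] that by simp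
    have "(\<Sum>b\<in>Basis. (z \<bullet> b) * (\<Sum>k<n. A (b # replicate k z @ h # replicate (n - 1 - k) z)))
      = (\<Sum>k<n. A (z # replicate k z @ h # replicate (n - 1 - k) z))"
      unfolding sum_distrib_left by (subst sum.swap) (rule sum.cong[OF refl], simp only: e lessThan_iff)
    moreover have "(\<Sum>b\<in>Basis. (h \<bullet> b) * A (b # replicate n z)) = A (h # replicate n z)"
      using multilinear_form_expand_head[OF Suc.prems, of "replicate n z" h] by simp
    ultimately show ?thesis
      by (simp add: sum.distrib sum.lessThan_Suc_shift del: sum.lessThan_Suc)
  qed
  ultimately show ?case by simp
qed

section \<open>The inner product and the dual norm of the operator\<close>

lemma le_of_square_le_mult:
  fixes x E :: real
  assumes "x\<^sup>2 \<le> E * x" "0 \<le> E" "0 \<le> x"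
  shows "x \<le> E"
proof (cases "x = 0")
  case False
  then have "0 < x" using assms by simp
  then show ?thesis using assms(1) unfolding power2_eq_square by (rule mult_right_le_imp_le[rotated])
qed (use assms in simp)

text \<open>
  The operator \<open>B\<close> provides an inner product, and every functional has the form \<open>B w\<close>; this turns all
  statements about the dual norm into statements about that inner product.
\<close>

locale euclidean_operator =
  fixes B :: "'a::euclidean_space \<Rightarrow>\<^sub>L ('a \<Rightarrow>\<^sub>L real)"
  assumes B: "self_adjoint_pos_def B"
begin

abbreviation ip :: "'a \<Rightarrow> 'a \<Rightarrow> real" where
  "ip x y \<equiv> blinfun_apply (blinfun_apply B x) y"

lemma ip_commute: "ip x y = ip y x"
  using B unfolding self_adjoint_pos_def_def by blast

lemma ip_pos: "x \<noteq> 0 \<Longrightarrow> 0 < ip x x"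
  using B unfolding self_adjoint_pos_def_def by blast

lemma ip_nonneg: "0 \<le> ip x x"
  using ip_pos[of x] by (cases "x = 0") (auto simp: blinfun.bilinear_simps)

lemmas ip_simps = blinfun.bilinear_simps

lemma Bnorm_nonneg [simp]: "0 \<le> Bnorm B x"
  using ip_nonneg by (simp add: Bnorm_def)

lemma Bnorm_sq: "(Bnorm B x)\<^sup>2 = ip x x"
  using ip_nonneg by (simp add: Bnorm_def)

lemma Bnorm_zero [simp]: "Bnorm B 0 = 0"
  by (simp add: Bnorm_def ip_simps)

lemma Bnorm_pos: "x \<noteq> 0 \<Longrightarrow> 0 < Bnorm B x"
  using ip_pos by (simp add: Bnorm_def)

lemma Bnorm_scaleR: "Bnorm B (c *\<^sub>R x) = \<bar>c\<bar> * Bnorm B x"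
  by (simp add: Bnorm_def ip_simps real_sqrt_mult flip: mult.assoc)

lemma Bnorm_minus_commute: "Bnorm B (x - y) = Bnorm B (y - x)"
  using Bnorm_scaleR[of "-1" "x - y"] by simp

lemma ip_Cauchy_Schwarz: "\<bar>ip x y\<bar> \<le> Bnorm B x * Bnorm B y"
proof (cases "y = 0")
  case True
  then show ?thesis by (simp add: ip_simps)
next
  case False
  define c where "c = ip x y / ip y y"
  have y: "0 < ip y y" by (rule ip_pos[OF False])
  have "0 \<le> ip (x - c *\<^sub>R y) (x - c *\<^sub>R y)" by (rule ip_nonneg)
  also have "\<dots> = ip x x - 2 * c * ip x y + c\<^sup>2 * ip y y"
    using ip_commute[of y x] by (simp add: ip_simps power2_eq_square algebra_simps)
  also have "\<dots> = ip x x - (ip x y)\<^sup>2 / ip y y"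
    using y by (simp add: c_def power2_eq_square field_simps)
  finally have "(ip x y)\<^sup>2 \<le> ip x x * ip y y" using y by (simp add: field_simps)
  then have "(\<bar>ip x y\<bar>)\<^sup>2 \<le> (Bnorm B x * Bnorm B y)\<^sup>2"
    by (simp add: power_mult_distrib Bnorm_sq)
  then show ?thesis by (rule power2_le_imp_le) simp
qed

text \<open>
  Composing \<open>B\<close> with the identification of functionals and vectors given by the standard inner
  product gives an injective linear map of the space to itself, hence a surjective one.
\<close>

lemma Riesz: obtains w where "s = blinfun_apply B w"
proof -
  define G where "G x = (\<Sum>b\<in>Basis. ip x b *\<^sub>R b)" for x
  have ipG: "G x \<bullet> y = ip x y" for x y
  proof -
    have "ip x y = ip x (\<Sum>b\<in>Basis. (y \<bullet> b) *\<^sub>R b)" by (simp add: euclidean_representation)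
    also have "\<dots> = G x \<bullet> y"
      by (simp add: G_def blinfun.sum_right ip_simps inner_sum_left inner_commute[of y] mult.commute)
    finally show ?thesis by simp
  qed
  have lin: "linear G"
    by (rule linearI) (simp_all add: G_def ip_simps scaleR_left_distrib sum.distrib scaleR_right.sum)
  have "inj G"
    unfolding linear_injective_0[OF lin] using ipG ip_pos by (metis inner_zero_left less_irrefl)
  then have "surj G" using linear_injective_imp_surjective[OF lin] by simp
  then obtain w where w: "G w = (\<Sum>b\<in>Basis. blinfun_apply s b *\<^sub>R b)" by (metis surjD)
  have "blinfun_apply s y = ip w y" for y
  proof -
    have "blinfun_apply s y = blinfun_apply s (\<Sum>b\<in>Basis. (y \<bullet> b) *\<^sub>R b)" by (simp add: euclidean_representation)
    also have "\<dots> = G w \<bullet> y"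
      by (simp add: w blinfun.sum_right ip_simps inner_sum_left inner_commute[of y] mult.commute)
    finally show ?thesis by (simp add: ipG)
  qed
  then have "s = blinfun_apply B w" by (intro blinfun_eqI)
  then show ?thesis by (rule that)
qed

lemma dual_Bnorm_B: "dual_Bnorm B (blinfun_apply B w) = Bnorm B w"
proof -
  have "inj (blinfun_apply B)"
  proof (rule injI)
    fix x y assume "blinfun_apply B x = blinfun_apply B y"
    then have "ip (x - y) (x - y) = 0" by (simp add: ip_simps)
    then show "x = y" using ip_pos[of "x - y"] by fastforce
  qed
  then show ?thesis by (simp add: dual_Bnorm_def Bnorm_def)
qed

lemma dual_Bnorm_nonneg [simp]: "0 \<le> dual_Bnorm B s"
  by (rule Riesz[of s]) (simp add: dual_Bnorm_B)

lemma dual_Bnorm_apply: "\<bar>blinfun_apply s h\<bar> \<le> dual_Bnorm B s * Bnorm B h"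
  by (rule Riesz[of s]) (simp add: dual_Bnorm_B ip_Cauchy_Schwarz)

text \<open>
  If \<open>g\<close> is within \<open>E\<close> of \<open>- k B w\<close> in the dual norm, then expanding the square of that distance
  bounds the inner product of \<open>g\<close> with \<open>w\<close>.
\<close>

lemma gradient_step_square:
  assumes "\<And>h. \<bar>blinfun_apply g h + k * ip w h\<bar> \<le> E * Bnorm B h" "0 \<le> E"
  shows "(dual_Bnorm B g)\<^sup>2 + 2 * k * blinfun_apply g w + k\<^sup>2 * (Bnorm B w)\<^sup>2 \<le> E\<^sup>2"
proof -
  obtain \<gamma> where \<gamma>: "g = blinfun_apply B \<gamma>" by (rule Riesz)
  define h where "h = \<gamma> + k *\<^sub>R w"
  have "blinfun_apply g h + k * ip w h = ip h h" by (simp add: \<gamma> h_def ip_simps algebra_simps)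
  then have "(Bnorm B h)\<^sup>2 \<le> E * Bnorm B h" using assms(1)[of h] by (simp add: Bnorm_sq)
  then have "Bnorm B h \<le> E"
    using assms(2) by (rule le_of_square_le_mult) simp
  then have "(Bnorm B h)\<^sup>2 \<le> E\<^sup>2" by (rule power_mono) simp
  moreover have "(Bnorm B h)\<^sup>2 = (dual_Bnorm B g)\<^sup>2 + 2 * k * blinfun_apply g w + k\<^sup>2 * (Bnorm B w)\<^sup>2"
  proof -
    have "ip h h = ip \<gamma> \<gamma> + 2 * k * ip \<gamma> w + k\<^sup>2 * ip w w"
      unfolding h_def ip_simps ip_commute[of w \<gamma>] real_scaleR_def by algebra
    then show ?thesis unfolding \<gamma> dual_Bnorm_B Bnorm_sq .
  qed
  ultimately show ?thesis by simp
qed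

lemma gradient_step_norm:
  assumes "\<And>h. \<bar>blinfun_apply g h + k * ip w h\<bar> \<le> E * Bnorm B h" "0 \<le> k" "0 \<le> E"
  shows "dual_Bnorm B g \<le> k * Bnorm B w + E"
proof -
  obtain \<gamma> where \<gamma>: "g = blinfun_apply B \<gamma>" by (rule Riesz)
  have "\<bar>ip \<gamma> \<gamma> + k * ip w \<gamma>\<bar> \<le> E * Bnorm B \<gamma>" using assms(1)[of \<gamma>] by (simp add: \<gamma>)
  moreover have "\<bar>k * ip w \<gamma>\<bar> \<le> k * (Bnorm B w * Bnorm B \<gamma>)"
    unfolding abs_mult using assms(2) ip_Cauchy_Schwarz[of w \<gamma>] by (simp add: mult_left_mono)
  ultimately have "(Bnorm B \<gamma>)\<^sup>2 \<le> (k * Bnorm B w + E) * Bnorm B \<gamma>"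
    unfolding Bnorm_sq by (simp add: algebra_simps abs_le_iff)
  then have "Bnorm B \<gamma> \<le> k * Bnorm B w + E"
    by (rule le_of_square_le_mult) (use assms in auto)
  then show ?thesis by (simp add: \<gamma> dual_Bnorm_B)
qed

text \<open>
  The regularizer must be differentiated at its centre too, because an inexact minimizer of the
  model may be the centre itself. There the \<open>r\<close>-th power is dominated by the square.
\<close>

lemma Bnorm_powr_has_derivative:
  assumes r: "2 \<le> r"
  shows "((\<lambda>y. Bnorm B (y - x) powr r) has_derivative
          (\<lambda>h. r * Bnorm B (y - x) powr (r - 2) * ip (y - x) h)) (at y)"
proof -
  have sq: "((\<lambda>y. ip (y - x) (y - x)) has_derivative (\<lambda>h. 2 * ip (y - x) h)) (at y)"
  proof -
    have "((\<lambda>y. ip (y - x) (y - x)) has_derivative (\<lambda>h. ip (y - x) h + ip h (y - x))) (at y)"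
      by (auto intro!: derivative_eq_intros simp: ip_simps)
    moreover have "ip (y - x) h + ip h (y - x) = 2 * ip (y - x) h" for h
      using ip_commute[of h "y - x"] by simp
    ultimately show ?thesis by simp
  qed
  have pw: "Bnorm B z powr r = ip z z powr (r / 2)" for z
    using ip_nonneg[of z] by (simp add: Bnorm_def powr_half_sqrt[symmetric] powr_powr)
  show ?thesis
  proof (cases "y = x")
    case False
    have pos: "0 < ip (y - x) (y - x)" using False by (intro ip_pos) simp
    have "((\<lambda>y. ip (y - x) (y - x) powr (r / 2)) has_derivative
        (\<lambda>h. (r / 2) * ip (y - x) (y - x) powr (r / 2 - 1) * (2 * ip (y - x) h))) (at y)"
      using has_derivative_powr[OF sq has_derivative_const[of "r/2"]] pos
      by (simp add: powr_diff algebra_simps)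
    moreover have "ip (y - x) (y - x) powr (r / 2 - 1) = Bnorm B (y - x) powr (r - 2)"
      using pos by (simp add: Bnorm_def powr_half_sqrt[symmetric] powr_powr diff_divide_distrib)
    ultimately show ?thesis by (simp add: pw mult.assoc)
  next
    case True
    have bl: "bounded_linear (\<lambda>h::'a. 0::real)" by simp
    have lim0: "((\<lambda>z. ip (z - x) (z - x) / norm (z - x)) \<longlongrightarrow> 0) (at x)"
    proof -
      have "((\<lambda>z. norm (ip (z - x) (z - x) - ip (x - x) (x - x) - 2 * ip (x - x) (z - x)) / norm (z - x)) \<longlongrightarrow> 0) (at x)"
        using sq unfolding True has_derivative_iff_norm by blast
      moreover have "norm (ip (z - x) (z - x) - ip (x - x) (x - x) - 2 * ip (x - x) (z - x)) = ip (z - x) (z - x)" for z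
        unfolding diff_self blinfun.zero_left using ip_nonneg[of "z - x"] by simp
      ultimately show ?thesis by simp
    qed
    have "continuous (at x) (\<lambda>z. ip (z - x) (z - x))"
      using has_derivative_continuous[OF sq] True by simp
    then have "((\<lambda>z. ip (z - x) (z - x)) \<longlongrightarrow> 0) (at x)"
      by (simp add: continuous_within ip_simps)
    then have ev: "\<forall>\<^sub>F z in at x. ip (z - x) (z - x) < 1"
      by (rule order_tendstoD) simp
    have "((\<lambda>z. norm (Bnorm B (z - x) powr r / norm (z - x))) \<longlongrightarrow> 0) (at x)"
    proof (rule tendsto_sandwich[OF _ _ tendsto_const lim0])
      show "\<forall>\<^sub>F z in at x. norm (Bnorm B (z - x) powr r / norm (z - x)) \<le> ip (z - x) (z - x) / norm (z - x)"
        using ev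
      proof eventually_elim
        case (elim z)
        have "ip (z - x) (z - x) powr (r / 2) \<le> ip (z - x) (z - x)"
          using powr_le1 powr_mono'[of 1 "r/2" "ip (z - x) (z - x)"] ip_nonneg[of "z - x"] elim r by simp
        then show ?case by (simp add: pw divide_right_mono)
      qed
    qed (simp add: always_eventually)
    then show ?thesis
      unfolding True has_derivative_iff_norm by (simp add: bl ip_simps)
  qed
qed

end

section \<open>Taylor expansion under a Holder condition\<close>

lemma grad_apply:
  assumes "(F has_derivative F') (at x)"
  shows "blinfun_apply (grad F x) = F'"
  using assms frechet_derivative_at[OF assms] has_derivative_bounded_linear[OF assms]
  by (simp add: grad_def bounded_linear_Blinfun_apply)

context euclidean_operator
begin

lemma prod_Bnorm_nonneg [simp]: "0 \<le> prod_list (map (Bnorm B) hs)"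
  by (induction hs) simp_all

text \<open>
  The norm of a form is defined as a supremum of reals, which is an upper bound of the values only if
  these are bounded. Boundedness follows by expanding one argument after the other in the basis, the
  coordinates being functionals of finite dual norm.
\<close>

lemma multilinear_form_bounded:
  assumes "multilinear_form n A"
  obtains K where "\<And>hs. length hs = n \<Longrightarrow> (\<forall>h\<in>set hs. Bnorm B h \<le> 1) \<Longrightarrow> \<bar>A hs\<bar> \<le> K"
proof -
  have "\<exists>K. \<forall>hs. length hs = n \<and> (\<forall>h\<in>set hs. Bnorm B h \<le> 1) \<longrightarrow> \<bar>A hs\<bar> \<le> K"
    using assms
  proof (induction n arbitrary: A)
    case 0
    show ?case by (rule exI[of _ "\<bar>A []\<bar>"]) simp
  next
    case (Suc n)
    have "\<forall>b. \<exists>K. \<forall>hs. length hs = n \<and> (\<forall>h\<in>set hs. Bnorm B h \<le> 1) \<longrightarrow> \<bar>A (b # hs)\<bar> \<le> K"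
      using Suc.IH[OF multilinear_form_Cons[OF Suc.prems]] by blast
    then obtain K where K: "\<And>b hs. length hs = n \<Longrightarrow> (\<forall>h\<in>set hs. Bnorm B h \<le> 1) \<Longrightarrow> \<bar>A (b # hs)\<bar> \<le> K b"
      by metis
    define c where "c b = dual_Bnorm B (blinfun_inner_right b)" for b :: 'a
    have "\<bar>A (h # hs)\<bar> \<le> (\<Sum>b\<in>Basis. c b * K b)"
      if "length hs = n" "\<forall>h\<in>set hs. Bnorm B h \<le> 1" "Bnorm B h \<le> 1" for h hs
    proof -
      have "\<bar>A (h # hs)\<bar> = \<bar>\<Sum>b\<in>Basis. (h \<bullet> b) * A (b # hs)\<bar>"
        using multilinear_form_expand_head[OF Suc.prems that(1)] by (rule arg_cong)
      also have "\<dots> \<le> (\<Sum>b\<in>Basis. c b * K b)"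
      proof (rule order_trans[OF sum_abs sum_mono])
        fix b :: 'a
        have "\<bar>h \<bullet> b\<bar> \<le> c b * Bnorm B h"
          using dual_Bnorm_apply[of "blinfun_inner_right b" h] by (simp add: c_def inner_commute)
        also have "\<dots> \<le> c b * 1" using that(3) by (intro mult_left_mono) (simp_all add: c_def)
        finally have "\<bar>h \<bullet> b\<bar> \<le> c b" by simp
        then show "\<bar>(h \<bullet> b) * A (b # hs)\<bar> \<le> c b * K b"
          unfolding abs_mult using K[OF that(1,2), of b] by (intro mult_mono) (auto simp: c_def)
      qed
      finally show ?thesis .
    qed
    then show ?case
      by (intro exI[of _ "\<Sum>b\<in>Basis. c b * K b"]) (auto simp: length_Suc_conv)
  qed
  then show ?thesis using that by blast
qed

lemma multilinear_form_le_prod: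
  assumes "multilinear_form n A"
    and "\<And>hs. length hs = n \<Longrightarrow> (\<forall>h\<in>set hs. Bnorm B h \<le> 1) \<Longrightarrow> \<bar>A hs\<bar> \<le> K"
    and "length hs = n"
  shows "\<bar>A hs\<bar> \<le> K * prod_list (map (Bnorm B) hs)"
  using assms
proof (induction n arbitrary: A hs)
  case 0
  then show ?case by simp
next
  case (Suc n)
  then obtain h ks where hs: "hs = h # ks" "length ks = n" by (auto simp: length_Suc_conv)
  have lin: "linear (\<lambda>h. A (h # ks))" by (rule multilinear_form_head[OF Suc.prems(1) hs(2)])
  show ?case
  proof (cases "h = 0")
    case True
    then show ?thesis using linear_0[OF lin] by (simp add: hs)
  next
    case False
    define u where "u = (1 / Bnorm B h) *\<^sub>R h"
    have pos: "0 < Bnorm B h" using False by (rule Bnorm_pos)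
    have u: "Bnorm B u = 1" "h = Bnorm B h *\<^sub>R u" using pos by (simp_all add: u_def Bnorm_scaleR)
    have "\<bar>A (u # ks)\<bar> \<le> K * prod_list (map (Bnorm B) ks)"
      using Suc.prems(2) u hs(2) by (intro Suc.IH[OF multilinear_form_Cons[OF Suc.prems(1)]]) auto
    then have "Bnorm B h * \<bar>A (u # ks)\<bar> \<le> Bnorm B h * (K * prod_list (map (Bnorm B) ks))"
      using pos by (simp add: mult_left_mono)
    moreover have "A (h # ks) = Bnorm B h * A (u # ks)"
      using linear_cmul[OF lin, of "Bnorm B h" u] by (simp flip: u(2))
    ultimately show ?thesis using pos by (simp add: hs abs_mult mult_ac)
  qed
qed

lemma form_norm_le:
  assumes "multilinear_form n A" "length hs = n"
  shows "\<bar>A hs\<bar> \<le> form_norm B n A * prod_list (map (Bnorm B) hs)"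
proof (rule multilinear_form_le_prod[OF assms(1) _ assms(2)])
  fix hs assume hs: "length hs = n" "\<forall>h\<in>set hs. Bnorm B h \<le> 1"
  obtain K where "\<And>hs. length hs = n \<Longrightarrow> (\<forall>h\<in>set hs. Bnorm B h \<le> 1) \<Longrightarrow> \<bar>A hs\<bar> \<le> K"
    using multilinear_form_bounded[OF assms(1)] by blast
  then have "bdd_above {\<bar>A hs\<bar> |hs. length hs = n \<and> (\<forall>h\<in>set hs. Bnorm B h \<le> 1)}"
    by (intro bdd_aboveI[of _ K]) auto
  then show "\<bar>A hs\<bar> \<le> form_norm B n A"
    unfolding form_norm_def using hs by (intro cSup_upper) auto
qed

end

locale holder_smooth = euclidean_operator B
  for B :: "'a::euclidean_space \<Rightarrow>\<^sub>L ('a \<Rightarrow>\<^sub>L real)" +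
  fixes f :: "'a \<Rightarrow> real" and p :: nat and \<nu> L :: real
  assumes p: "2 \<le> p"
    and diff: "times_differentiable p f"
    and nu: "0 \<le> \<nu>" "\<nu> \<le> 1"
    and Holder: "Holder_const B f p \<nu> < \<infinity>"
    and L: "L = real_of_ereal (Holder_const B f p \<nu>)"
begin

lemma form_norm_derivative_difference:
  assumes "x \<noteq> y"
  shows "form_norm B p (\<lambda>hs. higher_deriv f hs x - higher_deriv f hs y) \<le> L * Bnorm B (x - y) powr \<nu>"
proof -
  let ?q = "form_norm B p (\<lambda>hs. higher_deriv f hs x - higher_deriv f hs y) / Bnorm B (x - y) powr \<nu>"
  have le: "ereal ?q \<le> Holder_const B f p \<nu>"
    unfolding Holder_const_def using assms by (intro SUP_upper2[of "(x, y)"]) auto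
  then have "Holder_const B f p \<nu> = ereal L"
    unfolding L using Holder by (cases "Holder_const B f p \<nu>") auto
  then have "?q \<le> L" using le by simp
  moreover have "0 < Bnorm B (x - y) powr \<nu>" using assms Bnorm_pos[of "x - y"] by simp
  ultimately show ?thesis by (simp add: divide_le_eq)
qed

lemma multilinear_derivative_difference:
  "multilinear_form p (\<lambda>hs. higher_deriv f hs x - higher_deriv f hs y)"
  by (intro multilinear_form_diff multilinear_higher_deriv[OF diff]) simp_all

lemma Holder_const_nonneg: "0 \<le> L"
proof -
  obtain b :: 'a where b: "b \<in> Basis" using nonempty_Basis by blast
  then have b0: "b \<noteq> 0" by auto
  have ks: "\<bar>higher_deriv f hs b - higher_deriv f hs 0\<bar>
      \<le> L * Bnorm B b powr \<nu> * prod_list (map (Bnorm B) hs)" if "length hs = p" for hs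
    using form_norm_le[OF multilinear_derivative_difference that, of b 0]
      mult_right_mono[OF form_norm_derivative_difference[OF b0] prod_Bnorm_nonneg[of hs]]
    by simp
  have "prod_list (map (Bnorm B) (replicate p b)) = Bnorm B b ^ p"
    by (simp add: prod_list_replicate)
  then have "0 \<le> L * (Bnorm B b powr \<nu> * Bnorm B b ^ p)"
    using ks[of "replicate p b"] by (simp add: mult.assoc)
  moreover have "0 < Bnorm B b powr \<nu> * Bnorm B b ^ p" using Bnorm_pos[OF b0] by simp
  ultimately show ?thesis by (simp add: zero_le_mult_iff)
qed

lemma derivative_Holder:
  assumes "length hs = p"
  shows "\<bar>higher_deriv f hs x - higher_deriv f hs y\<bar>
           \<le> L * Bnorm B (x - y) powr \<nu> * prod_list (map (Bnorm B) hs)"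
proof (cases "x = y")
  case False
  show ?thesis
    using form_norm_le[OF multilinear_derivative_difference assms, of x y]
      mult_right_mono[OF form_norm_derivative_difference[OF False] prod_Bnorm_nonneg]
    by (rule order_trans)
qed simp

text \<open>
  The function \<open>\<tau> \<mapsto> D\<^sup>k f(x + \<tau> d)[hs]\<close>, \<open>k\<close> being the length of \<open>hs\<close>, has \<open>n\<close> derivatives, obtained by
  adding copies of \<open>d\<close> in front of \<open>hs\<close>. The Lagrange form of the remainder needs the \<open>n\<close>-th one only to
  exist, and the Holder condition compares its value at the intermediate point with that at \<open>x\<close>.
\<close>

lemma Taylor_bound:
  assumes "0 < n" "n + length hs = p"
  shows "\<bar>higher_deriv f hs (x + d) - (\<Sum>m<Suc n. higher_deriv f (replicate m d @ hs) x / fact m)\<bar>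
           \<le> L / fact n * Bnorm B d powr (n + \<nu>) * prod_list (map (Bnorm B) hs)"
proof -
  let ?D = "\<lambda>m \<tau>. higher_deriv f (replicate m d @ hs) (x + \<tau> *\<^sub>R d)"
  have deriv: "(?D m has_real_derivative ?D (Suc m) \<tau>) (at \<tau>)" if "m < n" for m \<tau>
  proof -
    let ?F = "higher_deriv f (replicate m d @ hs)"
    have F: "?F differentiable (at (x + \<tau> *\<^sub>R d))"
      using that assms by (intro higher_deriv_differentiable[OF diff]) simp
    have lin: "linear (frechet_derivative ?F (at (x + \<tau> *\<^sub>R d)))"
      using F by (rule linear_frechet_derivative)
    have "((\<lambda>\<tau>. ?F (x + \<tau> *\<^sub>R d)) has_derivative
            (\<lambda>r. frechet_derivative ?F (at (x + \<tau> *\<^sub>R d)) (r *\<^sub>R d))) (at \<tau>)"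
      by (rule has_derivative_compose[of "\<lambda>\<tau>. x + \<tau> *\<^sub>R d", OF _ F[unfolded frechet_derivative_works]])
         (auto intro!: derivative_eq_intros)
    moreover have "(\<lambda>r. frechet_derivative ?F (at (x + \<tau> *\<^sub>R d)) (r *\<^sub>R d)) = (*) (?D (Suc m) \<tau>)"
      by (rule ext) (simp add: linear_cmul[OF lin])
    ultimately show ?thesis unfolding has_field_derivative_def by simp
  qed
  obtain \<tau> where \<tau>: "0 < \<tau>" "\<tau> < 1"
    "?D 0 1 = (\<Sum>m<n. ?D m 0 / fact m * 1 ^ m) + ?D n \<tau> / fact n * 1 ^ n"
    using Maclaurin[of 1 n ?D "?D 0"] deriv assms(1) by auto
  have "higher_deriv f hs (x + d) - (\<Sum>m<Suc n. higher_deriv f (replicate m d @ hs) x / fact m)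
      = (?D n \<tau> - ?D n 0) / fact n"
    using \<tau>(3) by (simp add: diff_divide_distrib)
  then have "\<bar>higher_deriv f hs (x + d) - (\<Sum>m<Suc n. higher_deriv f (replicate m d @ hs) x / fact m)\<bar>
      = \<bar>?D n \<tau> - ?D n 0\<bar> / fact n"
    by (simp add: abs_divide)
  also have "\<bar>?D n \<tau> - ?D n 0\<bar> \<le> L * Bnorm B (\<tau> *\<^sub>R d) powr \<nu> * prod_list (map (Bnorm B) (replicate n d @ hs))"
    using derivative_Holder[of "replicate n d @ hs" "x + \<tau> *\<^sub>R d" "x + 0 *\<^sub>R d"] assms(2) by simp
  also have "\<dots> \<le> L * Bnorm B d powr \<nu> * prod_list (map (Bnorm B) (replicate n d @ hs))"
  proof (intro mult_right_mono mult_left_mono powr_mono2)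
    show "Bnorm B (\<tau> *\<^sub>R d) \<le> Bnorm B d" using \<tau> by (simp add: Bnorm_scaleR mult_left_le_one_le)
  qed (auto simp: nu Holder_const_nonneg simp del: map_append map_replicate)
  also have "\<dots> = L * Bnorm B d powr (n + \<nu>) * prod_list (map (Bnorm B) hs)"
  proof -
    have "Bnorm B d powr \<nu> * Bnorm B d ^ n = Bnorm B d powr (n + \<nu>)"
    proof (cases "Bnorm B d = 0")
      case True
      then show ?thesis using assms(1) by simp
    next
      case False
      then have "0 < Bnorm B d" using Bnorm_nonneg[of d] by linarith
      then show ?thesis by (simp add: powr_add powr_realpow)
    qed
    then show ?thesis by (simp add: prod_list_replicate mult.assoc flip: mult.assoc[of "Bnorm B d powr \<nu>"])
  qed
  finally show ?thesis by (simp add: divide_right_mono)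
qed

lemma model_upper_bound:
  "f (x + d) \<le> taylor_model f p x (x + d) + L / fact p * Bnorm B d powr (p + \<nu>)"
proof -
  have "(\<Sum>m<Suc p. higher_deriv f (replicate m d @ []) x / fact m)
      = f x + (\<Sum>i = 1..p. higher_deriv f (replicate i d) x / fact i)"
    by (simp add: sum.lessThan_Suc_shift sum.atLeast1_atMost_eq del: sum.lessThan_Suc replicate_Suc fact_Suc)
  then show ?thesis
    using Taylor_bound[of p "[]" x d] p by (simp add: taylor_model_def abs_le_iff del: sum.lessThan_Suc)
qed

lemma taylor_model_has_derivative:
  "(taylor_model f p x has_derivative
     (\<lambda>h. \<Sum>m<p. higher_deriv f (replicate m (y - x) @ [h]) x / fact m)) (at y)"
proof -
  let ?A = "\<lambda>hs. higher_deriv f hs x"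
  have A: "((\<lambda>z. ?A (replicate n z)) has_derivative (\<lambda>h. n * ?A (replicate (n - 1) z @ [h]))) (at z)"
    if "n \<le> p" for n z
  proof -
    have "(\<Sum>k<n. ?A (replicate k z @ h # replicate (n - 1 - k) z)) = n * ?A (replicate (n - 1) z @ [h])" for h
    proof -
      have "?A (replicate k z @ h # replicate (n - 1 - k) z) = ?A (replicate (n - 1) z @ [h])" if "k < n" for k
        using higher_deriv_move_last[OF diff, of k "n - 1 - k" z h x] that \<open>n \<le> p\<close> by simp
      then show ?thesis by simp
    qed
    then show ?thesis
      using multilinear_form_diagonal_derivative[OF multilinear_higher_deriv[OF diff that, of x], of z] by simp
  qed
  have A': "((\<lambda>y. ?A (replicate n (y - x))) has_derivative (\<lambda>h. n * ?A (replicate (n - 1) (y - x) @ [h]))) (at y)"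
    if "n \<le> p" for n
    by (rule has_derivative_compose[of "\<lambda>y. y - x", OF _ A[OF that]]) (auto intro!: derivative_eq_intros)
  have "(taylor_model f p x has_derivative
     (\<lambda>h. 0 + (\<Sum>i=1..p. 1 / fact i * (i * ?A (replicate (i - 1) (y - x) @ [h]))))) (at y)"
    unfolding taylor_model_def[abs_def]
    by (intro has_derivative_add has_derivative_const has_derivative_sum has_derivative_mult_right A') auto
  moreover have "0 + (\<Sum>i=1..p. 1 / fact i * (i * ?A (replicate (i - 1) (y - x) @ [h])))
      = (\<Sum>m<p. ?A (replicate m (y - x) @ [h]) / fact m)" for h
    by (simp add: sum.atLeast1_atMost_eq del: of_nat_Suc)
  ultimately show ?thesis by simp
qed

lemma f_has_derivative: "(f has_derivative blinfun_apply (grad f x)) (at x)"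
proof -
  have "f differentiable (at x)"
    using higher_deriv_differentiable[OF diff, of "[]"] p by simp
  then have "(f has_derivative frechet_derivative f (at x)) (at x)"
    unfolding frechet_derivative_works .
  then show ?thesis using grad_apply by metis
qed

lemma taylor_gradient_bound:
  "\<bar>blinfun_apply (grad f (x + d)) h - (\<Sum>m<p. higher_deriv f (replicate m d @ [h]) x / fact m)\<bar>
     \<le> L / fact (p - 1) * Bnorm B d powr (p + \<nu> - 1) * Bnorm B h"
proof -
  have "higher_deriv f [h] (x + d) = blinfun_apply (grad f (x + d)) h"
    using frechet_derivative_at[OF f_has_derivative] by simp
  then show ?thesis using Taylor_bound[of "p - 1" "[h]" x d] p
    by (simp add: of_nat_diff algebra_simps del: sum.lessThan_Suc)
qed

text \<open>
  What the inexactness conditions say about the point \<open>u\<close> once the model is replaced by \<open>f\<close>: the first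
  part combines the small gradient of the model with the error of the Taylor gradient, the second
  one the decrease of the model with the error of the Taylor polynomial.
\<close>

lemma model_step:
  fixes \<alpha> M :: real
  assumes "0 \<le> \<alpha>" "0 \<le> M" "approx_min B f p \<alpha> \<theta> M y u"
  shows "\<bar>blinfun_apply (grad f u) h + M * (p + \<alpha>) / fact p * Bnorm B (u - y) powr (p + \<alpha> - 2) * ip (u - y) h\<bar>
      \<le> (L / fact (p - 1) * Bnorm B (u - y) powr (p + \<nu> - 1) + \<theta> * Bnorm B (u - y) powr (p + \<alpha> - 1)) * Bnorm B h"
    and "M / fact p * Bnorm B (u - y) powr (p + \<alpha>) - L / fact p * Bnorm B (u - y) powr (p + \<nu>) \<le> f y - f u"
proof -
  have u: "y + (u - y) = u" by simp
  have "(regularized_model B f p \<alpha> M y has_derivative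
     (\<lambda>h. (\<Sum>m<p. higher_deriv f (replicate m (u - y) @ [h]) y / fact m)
        + M / fact p * ((p + \<alpha>) * Bnorm B (u - y) powr (p + \<alpha> - 2) * ip (u - y) h))) (at u)"
    unfolding regularized_model_def[abs_def]
    by (intro has_derivative_add taylor_model_has_derivative has_derivative_mult_right Bnorm_powr_has_derivative)
       (use p assms in auto)
  note grad_apply[OF this]
  then have "\<bar>(\<Sum>m<p. higher_deriv f (replicate m (u - y) @ [h]) y / fact m)
        + M / fact p * ((p + \<alpha>) * Bnorm B (u - y) powr (p + \<alpha> - 2) * ip (u - y) h)\<bar>
      \<le> dual_Bnorm B (grad (regularized_model B f p \<alpha> M y) u) * Bnorm B h"
    using dual_Bnorm_apply[of "grad (regularized_model B f p \<alpha> M y) u" h] by simp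
  also have "\<dots> \<le> \<theta> * Bnorm B (u - y) powr (p + \<alpha> - 1) * Bnorm B h"
    using assms(3) by (intro mult_right_mono) (auto simp: approx_min_def)
  finally show "\<bar>blinfun_apply (grad f u) h + M * (p + \<alpha>) / fact p * Bnorm B (u - y) powr (p + \<alpha> - 2) * ip (u - y) h\<bar>
      \<le> (L / fact (p - 1) * Bnorm B (u - y) powr (p + \<nu> - 1) + \<theta> * Bnorm B (u - y) powr (p + \<alpha> - 1)) * Bnorm B h"
    using taylor_gradient_bound[of y "u - y" h] unfolding u distrib_right[of _ _ "Bnorm B h"]
    by (simp add: mult.assoc)
  show "M / fact p * Bnorm B (u - y) powr (p + \<alpha>) - L / fact p * Bnorm B (u - y) powr (p + \<nu>) \<le> f y - f u"
    using model_upper_bound[of y "u - y"] assms(3) unfolding u approx_min_def regularized_model_def by simp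
qed

end

section \<open>Sufficient conditions for acceptance\<close>

text \<open>
  For \<open>\<sigma> \<le> 1\<close> the first term is at least \<open>1\<close>. For \<open>\<sigma> \<ge> 1\<close> and \<open>b \<ge> 3/4\<close> the second one suffices. In the
  remaining case \<open>b\<close> may be small or even \<open>0\<close> when \<open>q = 1\<close>, and both terms are bounded through
  \<open>\<sigma> powr c \<ge> 1 + c * ln \<sigma>\<close>: the bound on \<open>b\<close> makes the coefficient of \<open>ln \<sigma>\<close> nonnegative.
\<close>

lemma two_term_lower_bound:
  fixes q \<sigma> b :: real
  assumes q: "1 \<le> q" and \<sigma>: "0 < \<sigma>" and b: "3 / 4 \<le> b \<or> 1 - 1 / q\<^sup>2 \<le> b"
  shows "3 / 4 \<le> \<sigma> powr (1 - q) + b * \<sigma> powr (q + 1)"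
proof -
  have q2: "1 / q\<^sup>2 \<le> 1" using q by simp
  have b0: "0 \<le> b" using b q2 by linarith
  consider "\<sigma> \<le> 1" | "1 \<le> \<sigma>" "3 / 4 \<le> b" | "1 \<le> \<sigma>" "1 - 1 / q\<^sup>2 \<le> b" using b by linarith
  then show ?thesis
  proof cases
    case 1
    then have "1 \<le> \<sigma> powr (1 - q)" using powr_mono'[of "1 - q" 0 \<sigma>] \<sigma> q by simp
    moreover have "0 \<le> b * \<sigma> powr (q + 1)" using b0 by simp
    ultimately show ?thesis by linarith
  next
    case 2
    then have "1 \<le> \<sigma> powr (q + 1)" using q by (simp add: ge_one_powr_ge_zero)
    then have "b * 1 \<le> b * \<sigma> powr (q + 1)" using b0 by (intro mult_left_mono)
    moreover have "0 \<le> \<sigma> powr (1 - q)" by simp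
    ultimately show ?thesis using 2 by linarith
  next
    case 3
    define l where "l = ln \<sigma>"
    have l: "0 \<le> l" using 3 by (simp add: l_def)
    have pw: "1 + c * l \<le> \<sigma> powr c" for c
      using \<sigma> exp_ge_add_one_self[of "c * l"] by (simp add: powr_def l_def)
    have "(q - 1) * 1 \<le> (q - 1) * ((q + 1)\<^sup>2 / q\<^sup>2)"
      using q by (intro mult_left_mono) (auto simp: power_mono)
    also have "\<dots> = (1 - 1 / q\<^sup>2) * (q + 1)" using q by (simp add: field_simps power2_eq_square)
    also have "\<dots> \<le> b * (q + 1)" using 3 q by (intro mult_right_mono) auto
    finally have "(q - 1) * l \<le> b * (q + 1) * l" using l by (intro mult_right_mono) auto
    moreover have "b * (1 + (q + 1) * l) \<le> b * \<sigma> powr (q + 1)" using b0 pw by (intro mult_left_mono) auto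
    moreover have "1 + (1 - q) * l \<le> \<sigma> powr (1 - q)" by (rule pw)
    ultimately show ?thesis using b0 by (simp add: algebra_simps)
  qed
qed

lemma powr_double: "x powr (2 * q) = (x powr q)\<^sup>2" for x q :: real
  unfolding mult_2 powr_add power2_eq_square ..

text \<open>
  Here \<open>G\<close> is the norm of the new gradient, \<open>I\<close> its value at \<open>y - u\<close> and \<open>\<rho>\<close> the length of the step. Solving
  the quadratic estimate for \<open>I\<close> leaves a function of \<open>\<rho>\<close>. In units of \<open>S = (G / \<kappa>) powr (1 / q)\<close>,
  the length for which \<open>\<kappa> * S powr q = G\<close>, it is \<open>\<kappa> / 2 * S powr (q + 1)\<close> times the function
  in \<open>two_term_lower_bound\<close>.
\<close>

lemma step_inner_product_lower_bound:
  fixes G I \<kappa> \<rho> e q :: real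
  assumes pos: "0 < G" "0 < \<kappa>" "0 < \<rho>" "0 \<le> e" and q: "1 \<le> q"
    and sq: "G\<^sup>2 - 2 * (\<kappa> * \<rho> powr (q - 1)) * I + (\<kappa> * \<rho> powr (q - 1))\<^sup>2 * \<rho>\<^sup>2 \<le> (e * \<rho> powr q)\<^sup>2"
    and e: "2 * e \<le> \<kappa> \<or> q * e \<le> \<kappa>"
  shows "3 / 8 * (\<kappa> powr (- (1 / q)) * G powr ((q + 1) / q)) \<le> I"
proof -
  define S where "S = (G / \<kappa>) powr (1 / q)"
  have S: "0 < S" using pos by (simp add: S_def)
  have Sq: "S powr q = G / \<kappa>" using pos q by (simp add: S_def powr_powr)
  then have G: "G = \<kappa> * S powr q" using pos by (simp add: field_simps)
  define \<sigma> where "\<sigma> = \<rho> / S"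
  have \<sigma>: "0 < \<sigma>" "\<rho> = \<sigma> * S" using pos S by (simp_all add: \<sigma>_def)
  \<comment> \<open>the coefficient of \<open>\<rho> powr (q + 1)\<close> relative to that of \<open>\<rho> powr (1 - q)\<close> after rescaling\<close>
  define b where "b = 1 - (e / \<kappa>)\<^sup>2"
  have "3 / 4 \<le> b \<or> 1 - 1 / q\<^sup>2 \<le> b"
    using e
  proof
    assume "2 * e \<le> \<kappa>"
    then have "e / \<kappa> \<le> 1 / 2" using pos by (simp add: field_simps)
    then have "(e / \<kappa>)\<^sup>2 \<le> (1 / 2)\<^sup>2" using pos by (intro power_mono) auto
    then show ?thesis by (simp add: b_def power2_eq_square)
  next
    assume "q * e \<le> \<kappa>"
    then have "e / \<kappa> \<le> 1 / q" using pos q by (simp add: field_simps)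
    then have "(e / \<kappa>)\<^sup>2 \<le> (1 / q)\<^sup>2" using pos by (intro power_mono) auto
    then show ?thesis by (simp add: b_def power_divide)
  qed
  then have low: "3 / 4 \<le> \<sigma> powr (1 - q) + b * \<sigma> powr (q + 1)"
    by (rule two_term_lower_bound[OF q \<sigma>(1)])
  have 1: "(\<kappa> * \<rho> powr (q - 1))\<^sup>2 * \<rho>\<^sup>2 = \<kappa>\<^sup>2 * \<rho> powr (2 * q)"
  proof -
    have "\<rho> powr (q - 1) * \<rho> powr (q - 1) * \<rho> powr 2 = \<rho> powr (2 * q)"
      unfolding powr_add[symmetric] by simp
    then have "\<rho> powr (q - 1) * \<rho> powr (q - 1) * \<rho>\<^sup>2 = \<rho> powr (2 * q)"
      using pos by simp
    then show ?thesis unfolding power_mult_distrib power2_eq_square[of "\<rho> powr (q - 1)"] mult.assoc by simp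
  qed
  have 2: "(e * \<rho> powr q)\<^sup>2 = e\<^sup>2 * \<rho> powr (2 * q)"
    by (simp add: power_mult_distrib powr_double)
  have 3: "G\<^sup>2 = \<kappa>\<^sup>2 * S powr (2 * q)"
    by (simp add: G power_mult_distrib powr_double)
  have "\<kappa>\<^sup>2 * S powr (2 * q) + (\<kappa>\<^sup>2 - e\<^sup>2) * \<rho> powr (2 * q) \<le> 2 * (\<kappa> * \<rho> powr (q - 1)) * I"
    using sq unfolding 1 2 3 by (simp add: algebra_simps)
  moreover have "\<kappa>\<^sup>2 * S powr (2 * q) + (\<kappa>\<^sup>2 - e\<^sup>2) * \<rho> powr (2 * q)
      = (2 * (\<kappa> * \<rho> powr (q - 1))) * (\<kappa> / 2 * S powr (q + 1) * (\<sigma> powr (1 - q) + b * \<sigma> powr (q + 1)))"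
  proof -
    have \<rho>1: "\<rho> powr (q - 1) = \<sigma> powr (q - 1) * S powr (q - 1)"
      and \<rho>2: "\<rho> powr (2 * q) = \<sigma> powr (2 * q) * S powr (2 * q)"
      using S \<sigma> by (simp_all add: powr_mult)
    have S2: "S powr (q - 1) * S powr (q + 1) = S powr (2 * q)"
      and \<sigma>2: "\<sigma> powr (q - 1) * \<sigma> powr (q + 1) = \<sigma> powr (2 * q)"
      and \<sigma>0: "\<sigma> powr (q - 1) * \<sigma> powr (1 - q) = 1"
      unfolding powr_add[symmetric] using \<sigma> by simp_all
    have "\<rho> powr (q - 1) * S powr (q + 1) * \<sigma> powr (1 - q) = S powr (2 * q)"
      using \<rho>1 S2 \<sigma>0 by algebra
    moreover have "\<rho> powr (q - 1) * S powr (q + 1) * \<sigma> powr (q + 1) = \<rho> powr (2 * q)"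
      using \<rho>1 \<rho>2 S2 \<sigma>2 by algebra
    moreover have "\<kappa>\<^sup>2 - e\<^sup>2 = \<kappa>\<^sup>2 * b" using pos by (simp add: b_def power_divide field_simps)
    moreover have "(2 * (\<kappa> * \<rho> powr (q - 1))) * (\<kappa> / 2 * S powr (q + 1) * (\<sigma> powr (1 - q) + b * \<sigma> powr (q + 1)))
        = \<kappa>\<^sup>2 * (\<rho> powr (q - 1) * S powr (q + 1) * \<sigma> powr (1 - q))
          + \<kappa>\<^sup>2 * b * (\<rho> powr (q - 1) * S powr (q + 1) * \<sigma> powr (q + 1))"
      by (simp add: power2_eq_square algebra_simps)
    ultimately show ?thesis by simp
  qed
  ultimately have "\<kappa> / 2 * S powr (q + 1) * (\<sigma> powr (1 - q) + b * \<sigma> powr (q + 1)) \<le> I"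
    using pos by (simp del: mult_le_cancel_left times_divide_eq_left times_divide_eq_right add: mult_le_cancel_left_pos)
  moreover have "\<kappa> / 2 * S powr (q + 1) * (3 / 4) \<le> \<kappa> / 2 * S powr (q + 1) * (\<sigma> powr (1 - q) + b * \<sigma> powr (q + 1))"
    using low pos by (intro mult_left_mono) auto
  moreover have "\<kappa> powr (- (1 / q)) * G powr ((q + 1) / q) = \<kappa> * S powr (q + 1)"
  proof -
    have "G powr ((q + 1) / q) = \<kappa> powr ((q + 1) / q) * S powr (q + 1)"
      using pos S q by (simp add: G powr_mult powr_powr)
    moreover have "\<kappa> powr (- (1 / q)) * \<kappa> powr ((q + 1) / q) = \<kappa>"
    proof -
      have "- (1 / q) + (q + 1) / q = 1" using q by (simp add: field_simps)
      then show ?thesis using pos by (simp flip: powr_add)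
    qed
    ultimately show ?thesis by (simp flip: mult.assoc)
  qed
  ultimately show ?thesis by simp
qed

text \<open>
  The mechanism behind the case of unknown \<open>\<nu>\<close>: if the regularization \<open>M\<close> is large and the step
  nevertheless too short for the term of order \<open>p + 1\<close> to dominate the Taylor error, then the
  gradient at its end, whose norm is at most \<open>4 * c * \<rho> powr (p + \<nu> - 1)\<close>, does not exceed \<open>\<epsilon>\<close>. Taking
  logarithms makes the hypotheses and the conclusion linear.
\<close>

lemma short_step_bound:
  fixes c M \<rho> \<epsilon> \<nu> :: real and p :: nat
  assumes pos: "0 < c" "0 < M" "0 < \<rho>" "0 < \<epsilon>" and nu: "0 \<le> \<nu>" "\<nu> < 1" and p: "2 \<le> p"
    and M: "c powr (p / (p + \<nu> - 1)) * (4 / \<epsilon>) powr ((1 - \<nu>) / (p + \<nu> - 1)) \<le> M"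
    and \<rho>: "\<rho> powr (1 - \<nu>) \<le> c / M"
  shows "\<rho> powr (p + \<nu> - 1) \<le> \<epsilon> / (4 * c)"
proof -
  define r where "r = p + \<nu> - 1"
  have r: "0 < r" using nu p by (simp add: r_def)
  have "ln (c powr (p / r) * (4 / \<epsilon>) powr ((1 - \<nu>) / r)) \<le> ln M"
    using M pos by (subst ln_le_cancel_iff) (auto simp: r_def)
  then have "p / r * ln c + (1 - \<nu>) / r * ln (4 / \<epsilon>) \<le> ln M"
    using pos by (simp add: ln_mult ln_powr)
  then have a: "p * ln c + (1 - \<nu>) * ln (4 / \<epsilon>) \<le> r * ln M"
    using r by (simp add: field_simps)
  have "ln (\<rho> powr (1 - \<nu>)) \<le> ln (c / M)" using \<rho> pos by (subst ln_le_cancel_iff) auto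
  then have "(1 - \<nu>) * ln \<rho> \<le> ln c - ln M" using pos by (simp add: ln_powr ln_div)
  then have "r * ((1 - \<nu>) * ln \<rho>) \<le> r * (ln c - ln M)" using r by (intro mult_left_mono) auto
  with a have "(1 - \<nu>) * (r * ln \<rho>) \<le> (1 - \<nu>) * (- ln c - ln (4 / \<epsilon>))"
    by (simp add: r_def algebra_simps)
  then have "r * ln \<rho> \<le> - ln c - ln (4 / \<epsilon>)" using nu by simp
  also have "\<dots> = ln (\<epsilon> / (4 * c))" using pos by (simp add: ln_div ln_mult)
  finally have "exp (r * ln \<rho>) \<le> exp (ln (\<epsilon> / (4 * c)))" by simp
  then show ?thesis using pos by (simp add: powr_def r_def)
qed

lemma fact_ratio_bound: "2 \<le> p \<Longrightarrow> (real p + 1) / fact p \<le> 3 / 2 / fact (p - 1)"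
proof -
  assume p: "2 \<le> p"
  have "(real p + 1) / fact p = (real p + 1) / p / fact (p - 1)"
    using p by (simp add: fact_reduce)
  also have "\<dots> \<le> 3 / 2 / fact (p - 1)"
    using p by (intro divide_right_mono) (auto simp: field_simps)
  finally show ?thesis .
qed

context holder_smooth
begin

text \<open>
  The coefficient \<open>e\<close> collects the Taylor error and the inexactness. The two alternatives for its size
  belong to the two choices of \<open>\<alpha>\<close>: for known \<open>\<nu>\<close> the threshold carries the factor \<open>p + \<nu> - 1\<close>, which
  may equal \<open>1\<close>, for unknown \<open>\<nu>\<close> it guarantees the factor \<open>2\<close>.
\<close>

lemma accept_x_if:
  fixes \<alpha> M e :: real
  assumes \<alpha>: "0 \<le> \<alpha>" "\<alpha> \<le> 1" and M: "0 < M" and am: "approx_min B f p \<alpha> \<theta> M y u" and \<epsilon>: "0 < \<epsilon>"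
    and E: "u \<noteq> y \<Longrightarrow> L / fact (p - 1) * Bnorm B (u - y) powr (p + \<nu> - 1) + \<theta> * Bnorm B (u - y) powr (p + \<alpha> - 1)
        \<le> e * Bnorm B (u - y) powr (p + \<alpha> - 1)"
    and e: "0 \<le> e" "2 * e \<le> M * (p + \<alpha>) / fact p \<or> (p + \<alpha> - 1) * e \<le> M * (p + \<alpha>) / fact p"
  shows "accept_x B f p \<alpha> \<epsilon> M y u"
proof (cases "dual_Bnorm B (grad f u) \<le> \<epsilon>")
  case True
  then show ?thesis by (simp add: accept_x_def)
next
  case False
  define G where "G = dual_Bnorm B (grad f u)"
  define \<rho> where "\<rho> = Bnorm B (u - y)"
  define q where "q = p + \<alpha> - 1"
  define \<kappa> where "\<kappa> = M * (p + \<alpha>) / fact p"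
  have q: "1 \<le> q" using p \<alpha> by (simp add: q_def)
  have \<kappa>: "0 < \<kappa>" using M \<alpha> p by (simp add: \<kappa>_def)
  have G: "0 < G" using False \<epsilon> by (simp add: G_def)
  have stepE: "\<bar>blinfun_apply (grad f u) h + (\<kappa> * \<rho> powr (q - 1)) * ip (u - y) h\<bar>
      \<le> (L / fact (p - 1) * \<rho> powr (p + \<nu> - 1) + \<theta> * \<rho> powr q) * Bnorm B h" for h
    using model_step(1)[OF \<alpha>(1) _ am, of h] M by (simp add: \<kappa>_def \<rho>_def q_def)
  have \<rho>: "0 < \<rho>"
  proof (rule ccontr)
    assume "\<not> 0 < \<rho>"
    then have "\<rho> = 0" using Bnorm_nonneg[of "u - y"] by (simp add: \<rho>_def)
    then have "\<bar>blinfun_apply (grad f u) h + 0 * ip (u - y) h\<bar> \<le> 0 * Bnorm B h" for h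
      using stepE[of h] by simp
    from gradient_step_norm[OF this] G show False by (simp add: G_def)
  qed
  then have "u \<noteq> y" by (auto simp: \<rho>_def)
  then have E': "(L / fact (p - 1) * \<rho> powr (p + \<nu> - 1) + \<theta> * \<rho> powr q) * Bnorm B h \<le> e * \<rho> powr q * Bnorm B h" for h
    using E by (intro mult_right_mono) (auto simp: \<rho>_def q_def)
  have "G\<^sup>2 + 2 * (\<kappa> * \<rho> powr (q - 1)) * blinfun_apply (grad f u) (u - y) + (\<kappa> * \<rho> powr (q - 1))\<^sup>2 * \<rho>\<^sup>2 \<le> (e * \<rho> powr q)\<^sup>2"
    unfolding G_def \<rho>_def
    by (rule gradient_step_square) (use order_trans[OF stepE E'] e in \<open>auto simp: \<rho>_def\<close>)
  moreover have "blinfun_apply (grad f u) (u - y) = - blinfun_apply (grad f u) (y - u)"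
    by (simp add: blinfun.diff_right)
  ultimately have sq: "G\<^sup>2 - 2 * (\<kappa> * \<rho> powr (q - 1)) * blinfun_apply (grad f u) (y - u) + (\<kappa> * \<rho> powr (q - 1))\<^sup>2 * \<rho>\<^sup>2
      \<le> (e * \<rho> powr q)\<^sup>2" by simp
  have main: "3 / 8 * (\<kappa> powr (- (1 / q)) * G powr ((q + 1) / q)) \<le> blinfun_apply (grad f u) (y - u)"
    using e by (intro step_inner_product_lower_bound[OF G \<kappa> \<rho> e(1) q sq]) (simp add: \<kappa>_def q_def)
  have "2 / 3 * (fact (p - 1) / M) powr (1 / q) \<le> \<kappa> powr (- (1 / q))"
  proof -
    \<comment> \<open>the test is stated with \<open>(p - 1)! / M\<close>, which differs from \<open>1 / \<kappa>\<close> by this factor\<close>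
    define c where "c = p / (q + 1)"
    have c: "2 / 3 \<le> c" "c \<le> 1" "0 < c" using p \<alpha> by (auto simp: c_def q_def field_simps)
    have "fact p = real p * fact (p - 1)" using p by (simp add: fact_reduce)
    then have "1 / \<kappa> = c * (fact (p - 1) / M)"
      using M p \<alpha> by (simp add: \<kappa>_def c_def q_def field_simps)
    moreover have "\<kappa> powr (- (1 / q)) = (1 / \<kappa>) powr (1 / q)"
      using \<kappa> by (simp add: powr_minus powr_divide inverse_eq_divide)
    ultimately have "\<kappa> powr (- (1 / q)) = c powr (1 / q) * (fact (p - 1) / M) powr (1 / q)"
      using powr_mult[of c "fact (p - 1) / M" "1 / q"] c M by simp
    moreover have "2 / 3 \<le> c powr (1 / q)"
      using powr_mono'[of "1 / q" 1 c] c q by simp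
    ultimately show ?thesis using mult_right_mono[of "2 / 3" "c powr (1 / q)" "(fact (p - 1) / M) powr (1 / q)"] by simp
  qed
  then have "1 / 4 * ((fact (p - 1) / M) powr (1 / q) * G powr ((q + 1) / q)) \<le> 3 / 8 * (\<kappa> powr (- (1 / q)) * G powr ((q + 1) / q))"
    using mult_right_mono[of "2 / 3 * (fact (p - 1) / M) powr (1 / q)" "\<kappa> powr (- (1 / q))" "G powr ((q + 1) / q)"]
    by (simp add: mult_ac)
  with main show ?thesis by (simp add: accept_x_def G_def q_def)
qed

text \<open>
  The bound \<open>k powr (1 + 1 / q) \<le> 8\<close> is what the constant \<open>8 * (p + 1)!\<close> in the test leaves room for, as
  \<open>(p + 1)! \<ge> 3 * p!\<close>.
\<close>

lemma accept_z_if: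
  fixes \<alpha> M k :: real
  assumes \<alpha>: "0 \<le> \<alpha>" and M: "0 < M" and \<epsilon>: "0 < \<epsilon>" and k: "0 < k" "k powr (1 + 1 / (p + \<alpha> - 1)) \<le> 8"
    and G: "dual_Bnorm B (grad f u) \<le> M * k * Bnorm B (u - y) powr (p + \<alpha> - 1)"
    and dec: "M / (3 * fact p) * Bnorm B (u - y) powr (p + \<alpha>) \<le> f y - f u"
  shows "accept_z B f p \<alpha> \<epsilon> M y u"
proof -
  define G where "G = dual_Bnorm B (grad f u)"
  define \<rho> where "\<rho> = Bnorm B (u - y)"
  define q where "q = p + \<alpha> - 1"
  have q: "1 \<le> q" using p \<alpha> by (simp add: q_def)
  have e: "(q + 1) / q = 1 + 1 / q" using q by (simp add: field_simps)
  have "G powr ((q + 1) / q) \<le> (M * k * \<rho> powr q) powr ((q + 1) / q)"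
    using G q by (intro powr_mono2) (auto simp: G_def \<rho>_def q_def)
  also have "\<dots> = M powr (1 + 1 / q) * k powr (1 + 1 / q) * \<rho> powr (q + 1)"
    using M k q by (simp add: powr_mult powr_powr flip: e)
  finally have "1 / (8 * fact (p + 1) * M powr (1 / q)) * G powr ((q + 1) / q)
      \<le> 1 / (8 * fact (p + 1) * M powr (1 / q)) * (M powr (1 + 1 / q) * k powr (1 + 1 / q) * \<rho> powr (q + 1))"
    by (intro mult_left_mono) auto
  also have "\<dots> = M * \<rho> powr (q + 1) / fact (p + 1) * (k powr (1 + 1 / q) / 8)"
  proof -
    have "0 < M powr (1 / q)" using M by simp
    moreover have "M powr (1 + 1 / q) = M * M powr (1 / q)" using M by (simp add: powr_add)
    ultimately show ?thesis by (simp add: mult_ac)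
  qed
  also have "\<dots> \<le> M * \<rho> powr (q + 1) / fact (p + 1) * 1"
    using M k by (intro mult_left_mono) (auto simp: q_def)
  also have "\<dots> \<le> M / (3 * fact p) * \<rho> powr (q + 1)"
  proof -
    have "3 * fact p \<le> (fact (p + 1) :: real)" using p by simp
    then have "M * \<rho> powr (q + 1) / fact (p + 1) \<le> M * \<rho> powr (q + 1) / (3 * fact p)"
      using M by (intro divide_left_mono) auto
    then show ?thesis by simp
  qed
  also have "\<dots> \<le> f y - f u" using dec by (simp add: \<rho>_def q_def)
  finally show ?thesis by (simp add: accept_z_def G_def q_def)
qed

lemma gradient_norm_after_step:
  fixes \<alpha> M :: real
  assumes \<alpha>: "0 \<le> \<alpha>" "\<alpha> \<le> 1" and M: "0 < M" and am: "approx_min B f p \<alpha> \<theta> M y u" and \<theta>: "0 \<le> \<theta>"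
  shows "dual_Bnorm B (grad f u) \<le> (3 / 2 * M / fact (p - 1) + \<theta>) * Bnorm B (u - y) powr (p + \<alpha> - 1)
     + L / fact (p - 1) * Bnorm B (u - y) powr (p + \<nu> - 1)"
proof -
  define \<rho> where "\<rho> = Bnorm B (u - y)"
  define \<kappa> where "\<kappa> = M * (p + \<alpha>) / fact p"
  have \<kappa>: "0 \<le> \<kappa>" using M \<alpha> by (simp add: \<kappa>_def)
  have "dual_Bnorm B (grad f u) \<le> \<kappa> * \<rho> powr (p + \<alpha> - 2) * \<rho>
      + (L / fact (p - 1) * \<rho> powr (p + \<nu> - 1) + \<theta> * \<rho> powr (p + \<alpha> - 1))"
    unfolding \<rho>_def \<kappa>_def
    by (rule gradient_step_norm) (use model_step(1)[OF \<alpha>(1) _ am] M \<alpha> \<theta> Holder_const_nonneg in auto)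
  also have "\<kappa> * \<rho> powr (p + \<alpha> - 2) * \<rho> = \<kappa> * \<rho> powr (p + \<alpha> - 1)"
  proof (cases "\<rho> = 0")
    case False
    then have "0 < \<rho>" by (auto simp: \<rho>_def less_le)
    then have "\<rho> powr (p + \<alpha> - 2) * \<rho> powr 1 = \<rho> powr (p + \<alpha> - 1)" by (simp only: flip: powr_add) simp
    then show ?thesis using \<open>0 < \<rho>\<close> by simp
  qed simp
  also have "\<kappa> * \<rho> powr (p + \<alpha> - 1) \<le> (3 / 2 * M / fact (p - 1)) * \<rho> powr (p + \<alpha> - 1)"
  proof (rule mult_right_mono)
    have "\<kappa> \<le> M * ((real p + 1) / fact p)" using M \<alpha> by (simp add: \<kappa>_def divide_right_mono)
    also have "\<dots> \<le> M * (3 / 2 / fact (p - 1))" using M fact_ratio_bound[OF p] by (intro mult_left_mono) auto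
    finally show "\<kappa> \<le> 3 / 2 * M / fact (p - 1)" by simp
  qed simp
  finally show ?thesis by (simp add: \<rho>_def algebra_simps)
qed

section \<open>Acceptance for large regularization parameters\<close>

lemma fact_pred_ge_one: "1 \<le> (fact (p - 1) :: real)"
  by simp

lemma le_mult_fact_pred: "0 \<le> (\<theta> :: real) \<Longrightarrow> \<theta> \<le> \<theta> * fact (p - 1)"
  using mult_left_mono[OF fact_pred_ge_one, of \<theta>] by simp

lemma model_coefficient_ge:
  fixes M \<alpha> :: real
  shows "0 < M \<Longrightarrow> 0 \<le> \<alpha> \<Longrightarrow> M / fact (p - 1) \<le> M * (p + \<alpha>) / fact p"
proof -
  assume M: "0 < M" "0 \<le> \<alpha>"
  have "M / fact (p - 1) = M * p / fact p" using p by (simp add: fact_reduce)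
  also have "\<dots> \<le> M * (p + \<alpha>) / fact p"
    using M by (intro divide_right_mono mult_left_mono) auto
  finally show ?thesis .
qed

lemma accept_x_known:
  assumes M: "0 < M" and \<theta>: "0 \<le> \<theta>" and \<epsilon>: "0 < \<epsilon>" and am: "approx_min B f p \<nu> \<theta> M y u"
    and large: "(p + \<nu> - 1) * (L + \<theta> * fact (p - 1)) \<le> M"
  shows "accept_x B f p \<nu> \<epsilon> M y u"
proof (rule accept_x_if[OF nu M am \<epsilon>])
  show "L / fact (p - 1) * Bnorm B (u - y) powr (p + \<nu> - 1) + \<theta> * Bnorm B (u - y) powr (p + \<nu> - 1)
     \<le> (L / fact (p - 1) + \<theta>) * Bnorm B (u - y) powr (p + \<nu> - 1)"
    by (simp add: distrib_right)
  show "0 \<le> L / fact (p - 1) + \<theta>" using \<theta> Holder_const_nonneg by simp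
  have "(p + \<nu> - 1) * (L / fact (p - 1) + \<theta>) = (p + \<nu> - 1) * (L + \<theta> * fact (p - 1)) / fact (p - 1)"
    by (simp add: field_simps)
  also have "\<dots> \<le> M / fact (p - 1)" using large by (intro divide_right_mono) auto
  finally show "2 * (L / fact (p - 1) + \<theta>) \<le> M * (p + \<nu>) / fact p \<or>
     (p + \<nu> - 1) * (L / fact (p - 1) + \<theta>) \<le> M * (p + \<nu>) / fact p"
    using model_coefficient_ge[OF M nu(1)] by linarith
qed

lemma accept_z_known:
  assumes M: "0 < M" and \<theta>: "0 \<le> \<theta>" and \<epsilon>: "0 < \<epsilon>" and am: "approx_min B f p \<nu> \<theta> M y u"
    and large: "3 * L / 2 \<le> M" "3 * \<theta> * fact (p - 1) \<le> M"
  shows "accept_z B f p \<nu> \<epsilon> M y u"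
proof (rule accept_z_if[OF nu(1) M \<epsilon>])
  let ?\<rho> = "Bnorm B (u - y)"
  \<comment> \<open>5/2 is the sum of 3/2 from the regularizer, 1/3 from the inexactness and 2/3 from the Taylor error\<close>
  have "(5 / 2 :: real) powr (1 + 1 / (p + \<nu> - 1)) \<le> (5 / 2) powr 2"
    using p nu by (intro powr_mono) auto
  also have "(5 / 2 :: real) powr 2 \<le> 8" by (simp add: powr_numeral power2_eq_square)
  finally show "(5 / 2 :: real) powr (1 + 1 / (p + \<nu> - 1)) \<le> 8" .
  have "3 / 2 * M / fact (p - 1) + \<theta> + L / fact (p - 1) = (3 / 2 * M + \<theta> * fact (p - 1) + L) / fact (p - 1)"
    by (simp add: field_simps)
  also have "\<dots> \<le> (5 / 2 * M) / fact (p - 1)"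
    using large by (intro divide_right_mono) auto
  also have "\<dots> \<le> (5 / 2 * M) / 1"
    using fact_pred_ge_one M by (intro divide_left_mono) auto
  finally have c: "3 / 2 * M / fact (p - 1) + \<theta> + L / fact (p - 1) \<le> M * (5 / 2)" by simp
  have "dual_Bnorm B (grad f u) \<le> (3 / 2 * M / fact (p - 1) + \<theta> + L / fact (p - 1)) * ?\<rho> powr (p + \<nu> - 1)"
    using gradient_norm_after_step[OF nu M am \<theta>] by (simp add: algebra_simps)
  also have "\<dots> \<le> M * (5 / 2) * ?\<rho> powr (p + \<nu> - 1)" using c by (rule mult_right_mono) simp
  finally show "dual_Bnorm B (grad f u) \<le> M * (5 / 2) * ?\<rho> powr (p + \<nu> - 1)" .
  have "M / (3 * fact p) * ?\<rho> powr (p + \<nu>) \<le> (M - L) / fact p * ?\<rho> powr (p + \<nu>)"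
  proof (rule mult_right_mono)
    have "M / 3 / fact p \<le> (M - L) / fact p" using large by (intro divide_right_mono) auto
    then show "M / (3 * fact p) \<le> (M - L) / fact p" by simp
  qed simp
  also have "\<dots> \<le> f y - f u"
    using model_step(2)[OF nu(1) _ am] M by (simp add: diff_divide_distrib left_diff_distrib)
  finally show "M / (3 * fact p) * ?\<rho> powr (p + \<nu>) \<le> f y - f u" .
qed (use M in auto)

lemma shift_exponent:
  assumes "0 < \<rho>"
  shows "\<rho> powr (p + \<nu> - 1) = \<rho> powr p * \<rho> powr (\<nu> - 1)"
    and "\<rho> powr p = \<rho> powr (p + \<nu> - 1) * \<rho> powr (1 - \<nu>)"
    and "\<rho> powr (p + \<nu>) = \<rho> powr (p + 1) * \<rho> powr (\<nu> - 1)"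
  unfolding powr_add[symmetric] by (simp_all add: algebra_simps)

text \<open>
  Either the Taylor error is dominated by the regularization, or the step is short in the sense of the
  preceding estimate. For \<open>\<nu> = 1\<close> the lower bound on \<open>M\<close> is the first alternative.
\<close>

lemma short_step_dichotomy:
  assumes c: "0 < c" and M: "0 < M" and \<epsilon>: "0 < \<epsilon>" and \<rho>: "0 < \<rho>"
    and large: "(c * L) powr (p / (p + \<nu> - 1)) * (4 / \<epsilon>) powr ((1 - \<nu>) / (p + \<nu> - 1)) \<le> M"
  obtains "c * L * \<rho> powr (\<nu> - 1) \<le> M"
    | "0 < L" "\<rho> powr (1 - \<nu>) \<le> c * L / M" "\<rho> powr (p + \<nu> - 1) \<le> \<epsilon> / (4 * (c * L))"
proof (cases "c * L * \<rho> powr (\<nu> - 1) \<le> M")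
  case False
  then have "L \<noteq> 0" using M by auto
  then have L: "0 < L" using Holder_const_nonneg by simp
  have "\<nu> \<noteq> 1"
  proof
    assume "\<nu> = 1"
    then show False using large False p \<rho> \<epsilon> c L by simp
  qed
  then have nu1: "\<nu> < 1" using nu by simp
  have "\<rho> powr (\<nu> - 1) * \<rho> powr (1 - \<nu>) = 1" unfolding powr_add[symmetric] using \<rho> by simp
  moreover have "M * \<rho> powr (1 - \<nu>) \<le> c * L * \<rho> powr (\<nu> - 1) * \<rho> powr (1 - \<nu>)"
    using False by (intro mult_right_mono) auto
  ultimately have "M * \<rho> powr (1 - \<nu>) \<le> c * L" by (simp add: mult.assoc)
  then have short: "\<rho> powr (1 - \<nu>) \<le> c * L / M" using M by (simp add: field_simps)
  have "0 < c * L" using c L by simp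
  from short_step_bound[OF this M \<rho> \<epsilon> nu(1) nu1 p large short] show ?thesis
    by (rule that(2)[OF L short])
qed (rule that(1))

lemma accept_x_unknown:
  assumes M: "0 < M" and \<theta>: "0 \<le> \<theta>" and \<epsilon>: "0 < \<epsilon>" and am: "approx_min B f p 1 \<theta> M y u"
    and large: "4 * \<theta> * fact (p - 1) \<le> M"
      "(4 * L) powr (p / (p + \<nu> - 1)) * (4 / \<epsilon>) powr ((1 - \<nu>) / (p + \<nu> - 1)) \<le> M"
  shows "accept_x B f p 1 \<epsilon> M y u"
proof (cases "dual_Bnorm B (grad f u) \<le> \<epsilon>")
  case True
  then show ?thesis by (simp add: accept_x_def)
next
  case False
  define \<rho> where "\<rho> = Bnorm B (u - y)"
  show ?thesis
  proof (rule accept_x_if[where e = "M / (2 * fact (p - 1))", OF _ _ M am \<epsilon>])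
    show "0 \<le> M / (2 * fact (p - 1))" using M by simp
    show "2 * (M / (2 * fact (p - 1))) \<le> M * (real p + 1) / fact p \<or> (real p + 1 - 1) * (M / (2 * fact (p - 1))) \<le> M * (real p + 1) / fact p"
      using model_coefficient_ge[OF M, of 1] by simp
    assume "u \<noteq> y"
    then have \<rho>: "0 < \<rho>" using Bnorm_pos[of "u - y"] by (simp add: \<rho>_def)
    \<comment> \<open>for a shorter step all parts of the gradient are multiples of \<open>L * \<rho> powr (p + \<nu> - 1)\<close>, hence small\<close>
    have "4 * L * \<rho> powr (\<nu> - 1) \<le> M"
    proof (rule short_step_dichotomy[OF _ M \<epsilon> \<rho> large(2)])
      assume L: "0 < L" and s: "\<rho> powr (1 - \<nu>) \<le> 4 * L / M" "\<rho> powr (p + \<nu> - 1) \<le> \<epsilon> / (4 * (4 * L))"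
      have "dual_Bnorm B (grad f u) \<le> (3 / 2 * M / fact (p - 1) + \<theta>) * \<rho> powr p + L / fact (p - 1) * \<rho> powr (p + \<nu> - 1)"
        using gradient_norm_after_step[OF _ _ M am \<theta>] by (simp add: \<rho>_def)
      also have "\<dots> = ((3 / 2 * M / fact (p - 1) + \<theta>) * \<rho> powr (1 - \<nu>) + L / fact (p - 1)) * \<rho> powr (p + \<nu> - 1)"
        by (simp add: shift_exponent(2)[OF \<rho>] distrib_right)
      also have "\<dots> \<le> (8 * L) * (\<epsilon> / (4 * (4 * L)))"
      proof (intro mult_mono s)
        have "(3 / 2 * M / fact (p - 1) + \<theta>) * \<rho> powr (1 - \<nu>) \<le> (7 / 4 * M) * (4 * L / M)"
        proof (intro mult_mono s)
          have "3 / 2 * M / fact (p - 1) \<le> 3 / 2 * M / 1" using M by (intro divide_left_mono) auto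
          then show "3 / 2 * M / fact (p - 1) + \<theta> \<le> 7 / 4 * M" using le_mult_fact_pred[OF \<theta>] large(1) by simp
        qed (use M in auto)
        also have "\<dots> = 7 * L" using M by simp
        finally have "(3 / 2 * M / fact (p - 1) + \<theta>) * \<rho> powr (1 - \<nu>) \<le> 7 * L" .
        moreover have "L / fact (p - 1) \<le> L / 1" using L by (intro divide_left_mono) auto
        ultimately show "(3 / 2 * M / fact (p - 1) + \<theta>) * \<rho> powr (1 - \<nu>) + L / fact (p - 1) \<le> 8 * L" by simp
      qed (use L in auto)
      also have "\<dots> \<le> \<epsilon>" using L \<epsilon> by simp
      finally show ?thesis using False by simp
    qed simp_all
    then have "(L * \<rho> powr (\<nu> - 1) + \<theta> * fact (p - 1)) / fact (p - 1) \<le> (M / 2) / fact (p - 1)"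
      using large(1) by (intro divide_right_mono) auto
    then have "(L / fact (p - 1) * \<rho> powr (\<nu> - 1) + \<theta>) \<le> M / (2 * fact (p - 1))"
      by (simp add: add_divide_distrib)
    then have "(L / fact (p - 1) * \<rho> powr (\<nu> - 1) + \<theta>) * \<rho> powr p \<le> M / (2 * fact (p - 1)) * \<rho> powr p"
      by (rule mult_right_mono) simp
    then show "L / fact (p - 1) * Bnorm B (u - y) powr (p + \<nu> - 1) + \<theta> * Bnorm B (u - y) powr (real p + 1 - 1)
      \<le> M / (2 * fact (p - 1)) * Bnorm B (u - y) powr (real p + 1 - 1)"
      unfolding \<rho>_def[symmetric] shift_exponent(1)[OF \<rho>] by (simp add: algebra_simps)
  qed simp_all
qed

lemma accept_z_unknown:
  assumes M: "0 < M" and \<theta>: "0 \<le> \<theta>" and \<epsilon>: "0 < \<epsilon>" and am: "approx_min B f p 1 \<theta> M y u"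
    and large: "\<theta> \<le> M"
      "(3 * L / 2) powr (p / (p + \<nu> - 1)) * (4 / \<epsilon>) powr ((1 - \<nu>) / (p + \<nu> - 1)) \<le> M"
  shows "accept_z B f p 1 \<epsilon> M y u"
proof (cases "dual_Bnorm B (grad f u) \<le> \<epsilon>")
  case True
  then show ?thesis by (simp add: accept_z_def)
next
  case False
  define \<rho> where "\<rho> = Bnorm B (u - y)"
  have G: "dual_Bnorm B (grad f u) \<le> (3 / 2 * M / fact (p - 1) + \<theta>) * \<rho> powr p + L / fact (p - 1) * \<rho> powr (p + \<nu> - 1)"
    using gradient_norm_after_step[OF _ _ M am \<theta>] by (simp add: \<rho>_def)
  have c: "3 / 2 * M / fact (p - 1) + \<theta> \<le> 5 / 2 * M"
  proof -
    have "3 / 2 * M / fact (p - 1) \<le> 3 / 2 * M / 1" using M by (intro divide_left_mono) auto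
    then show ?thesis using large(1) by simp
  qed
  have "\<rho> \<noteq> 0" using G False \<epsilon> by auto
  then have \<rho>: "0 < \<rho>" by (auto simp: \<rho>_def less_le)
  \<comment> \<open>a shorter step would again end at a gradient of norm at most \<open>\<epsilon>\<close>\<close>
  have key: "3 / 2 * L * \<rho> powr (\<nu> - 1) \<le> M"
  proof (rule short_step_dichotomy[of "3 / 2", OF _ M \<epsilon> \<rho>])
    show "(3 / 2 * L) powr (p / (p + \<nu> - 1)) * (4 / \<epsilon>) powr ((1 - \<nu>) / (p + \<nu> - 1)) \<le> M"
      using large(2) by simp
    assume L: "0 < L" and s: "\<rho> powr (1 - \<nu>) \<le> 3 / 2 * L / M" "\<rho> powr (p + \<nu> - 1) \<le> \<epsilon> / (4 * (3 / 2 * L))"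
    note G
    also have "(3 / 2 * M / fact (p - 1) + \<theta>) * \<rho> powr p + L / fact (p - 1) * \<rho> powr (p + \<nu> - 1)
        = ((3 / 2 * M / fact (p - 1) + \<theta>) * \<rho> powr (1 - \<nu>) + L / fact (p - 1)) * \<rho> powr (p + \<nu> - 1)"
      by (simp add: shift_exponent(2)[OF \<rho>] distrib_right)
    also have "\<dots> \<le> (5 * L) * (\<epsilon> / (4 * (3 / 2 * L)))"
    proof (intro mult_mono s)
      have "(3 / 2 * M / fact (p - 1) + \<theta>) * \<rho> powr (1 - \<nu>) \<le> (5 / 2 * M) * (3 / 2 * L / M)"
        by (intro mult_mono s c) (use M in auto)
      also have "\<dots> \<le> 4 * L" using M L by simp
      finally have "(3 / 2 * M / fact (p - 1) + \<theta>) * \<rho> powr (1 - \<nu>) \<le> 4 * L" .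
      moreover have "L / fact (p - 1) \<le> L / 1" using L by (intro divide_left_mono) auto
      ultimately show "(3 / 2 * M / fact (p - 1) + \<theta>) * \<rho> powr (1 - \<nu>) + L / fact (p - 1) \<le> 5 * L" by simp
    qed (use L in auto)
    also have "\<dots> \<le> \<epsilon>" using L \<epsilon> by simp
    finally show ?thesis using False by simp
  qed simp_all
  show ?thesis
  proof (rule accept_z_if[where k = 4, OF _ M \<epsilon>])
    \<comment> \<open>the exponent is at most \<open>3/2\<close> because \<open>p \<ge> 2\<close>, which permits the coefficient 4\<close>
    have "(4 :: real) powr (1 + 1 / (real p + 1 - 1)) \<le> 4 powr (3 / 2)"
      using p by (intro powr_mono) (auto simp: field_simps)
    also have "(4 :: real) powr (3 / 2) = (2 powr 2) powr (3 / 2)" by simp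
    also have "\<dots> = 2 powr 3" by (subst powr_powr) simp
    also have "\<dots> = 8" by simp
    finally show "(4 :: real) powr (1 + 1 / (real p + 1 - 1)) \<le> 8" .
    have "L / fact (p - 1) * \<rho> powr (\<nu> - 1) \<le> L / 1 * \<rho> powr (\<nu> - 1)"
      using Holder_const_nonneg by (intro mult_right_mono divide_left_mono) auto
    then have "3 / 2 * M / fact (p - 1) + \<theta> + L / fact (p - 1) * \<rho> powr (\<nu> - 1) \<le> M * 4"
      using c key M by linarith
    then have "(3 / 2 * M / fact (p - 1) + \<theta> + L / fact (p - 1) * \<rho> powr (\<nu> - 1)) * \<rho> powr p \<le> M * 4 * \<rho> powr p"
      by (rule mult_right_mono) simp
    moreover have "dual_Bnorm B (grad f u) \<le> (3 / 2 * M / fact (p - 1) + \<theta> + L / fact (p - 1) * \<rho> powr (\<nu> - 1)) * \<rho> powr p"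
      using G unfolding shift_exponent(1)[OF \<rho>] by (simp add: algebra_simps)
    ultimately show "dual_Bnorm B (grad f u) \<le> M * 4 * Bnorm B (u - y) powr (real p + 1 - 1)"
      by (simp add: \<rho>_def)
    have "M / 3 \<le> M - L * \<rho> powr (\<nu> - 1)" using key by simp
    then have "M / 3 / fact p \<le> (M - L * \<rho> powr (\<nu> - 1)) / fact p" by (rule divide_right_mono) simp
    then have "M / (3 * fact p) * \<rho> powr (real p + 1) \<le> (M - L * \<rho> powr (\<nu> - 1)) / fact p * \<rho> powr (real p + 1)"
      by (intro mult_right_mono) auto
    also have "\<dots> = M / fact p * \<rho> powr (real p + 1) - L / fact p * \<rho> powr (p + \<nu>)"
      unfolding shift_exponent(3)[OF \<rho>] by (simp add: diff_divide_distrib algebra_simps)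
    also have "\<dots> \<le> f y - f u"
      using model_step(2)[OF _ _ am] M by (simp add: \<rho>_def)
    finally show "M / (3 * fact p) * Bnorm B (u - y) powr (real p + 1) \<le> f y - f u" by (simp add: \<rho>_def)
  qed simp_all
qed

lemma accept_x_large:
  assumes "0 < M" "0 \<le> \<theta>" "0 < \<epsilon>" "approx_min B f p (alpha_exp known \<nu>) \<theta> M y u"
    and "Nt_const known p \<nu> \<theta> L \<epsilon> \<le> M"
  shows "accept_x B f p (alpha_exp known \<nu>) \<epsilon> M y u"
  using assms accept_x_known accept_x_unknown
  by (cases known) (auto simp: alpha_exp_def Nt_const_def)

lemma accept_z_large:
  assumes "0 < M" "0 \<le> \<theta>" "0 < \<epsilon>" "\<epsilon> < 1" "approx_min B f p (alpha_exp known \<nu>) \<theta> M y u"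
    and "N_const known p \<nu> \<theta> L \<epsilon> \<le> M"
  shows "accept_z B f p (alpha_exp known \<nu>) \<epsilon> M y u"
proof (cases known)
  case True
  then show ?thesis using assms accept_z_known by (auto simp: alpha_exp_def N_const_def)
next
  case False
  let ?w = "(1 - \<nu>) / (p + \<nu> - 1)"
  let ?c = "(3 * L / 2) powr (p / (p + \<nu> - 1)) * 4 powr ?w"
  have w: "0 \<le> ?w" using nu p by simp
  have e1: "1 \<le> \<epsilon> powr (- ?w)" using powr_mono'[of "- ?w" 0 \<epsilon>] assms w by simp
  have le: "max \<theta> ?c * \<epsilon> powr (- ?w) \<le> M"
    using assms(6) False by (simp add: N_const_def)
  have "\<theta> * 1 \<le> max \<theta> ?c * \<epsilon> powr (- ?w)" using e1 assms by (intro mult_mono) auto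
  then have 1: "\<theta> \<le> M" using le by simp
  have "?c * \<epsilon> powr (- ?w) \<le> max \<theta> ?c * \<epsilon> powr (- ?w)" by (intro mult_right_mono) auto
  moreover have "4 powr ?w * \<epsilon> powr (- ?w) = (4 / \<epsilon>) powr ?w"
  proof -
    have "\<epsilon> powr (- ?w) = 1 / \<epsilon> powr ?w" by (rule powr_minus_divide)
    then show ?thesis using assms by (simp add: powr_divide)
  qed
  ultimately have 2: "(3 * L / 2) powr (p / (p + \<nu> - 1)) * (4 / \<epsilon>) powr ?w \<le> M"
    using le by (simp add: mult.assoc)
  show ?thesis
    using accept_z_unknown[OF assms(1-3) _ 1 2] assms(5) False by (simp add: alpha_exp_def)
qed

end

section \<open>Inequalities for powers\<close>

lemma powr_midpoint_le:
  fixes a b s :: real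
  assumes "0 \<le> a" "0 \<le> b" "1 \<le> s"
  shows "((a + b) / 2) powr s \<le> (a powr s + b powr s) / 2"
proof -
  have half: "(c / 2) powr s \<le> c powr s / 2" if "0 \<le> c" for c :: real
  proof -
    have "(1 / 2 :: real) powr s \<le> 1 / 2" using powr_mono'[of 1 s "1 / 2"] assms by simp
    then have "c powr s * (1 / 2) powr s \<le> c powr s * (1 / 2)" by (rule mult_left_mono) simp
    then show ?thesis using powr_mult[of c "1 / 2" s] that by simp
  qed
  consider "a = 0" | "b = 0" | "0 < a" "0 < b" using assms by linarith
  then show ?thesis
  proof cases
    case 3
    then show ?thesis
      using convex_onD[OF powr_convex[OF assms(3)], of "1 / 2" a b] by (simp add: field_simps)
  qed (use half assms in auto)
qed

text \<open>
  Since \<open>c / (a + b) \<le> 1\<close> for both summands \<open>c\<close>, raising it to a power \<open>s \<ge> 1\<close> does not increase it.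
\<close>

lemma powr_superadditive:
  fixes a b s :: real
  assumes "0 \<le> a" "0 \<le> b" "1 \<le> s"
  shows "a powr s + b powr s \<le> (a + b) powr s"
proof (cases "a + b = 0")
  case True
  then show ?thesis using assms by (simp add: add_nonneg_eq_0_iff)
next
  case False
  then have pos: "0 < a + b" using assms by simp
  have part: "c powr s \<le> c / (a + b) * (a + b) powr s" if "0 \<le> c" "c \<le> a + b" for c
  proof -
    have "(c / (a + b)) powr s \<le> c / (a + b)"
      using powr_mono'[of 1 s "c / (a + b)"] assms that pos by simp
    then have "(c / (a + b)) powr s * (a + b) powr s \<le> c / (a + b) * (a + b) powr s"
      by (rule mult_right_mono) simp
    moreover have "(c / (a + b)) powr s * (a + b) powr s = c powr s"
      using that pos by (simp add: powr_divide)
    ultimately show ?thesis by simp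
  qed
  have "a powr s + b powr s \<le> a / (a + b) * (a + b) powr s + b / (a + b) * (a + b) powr s"
    using part[of a] part[of b] assms by simp
  also have "\<dots> = (a / (a + b) + b / (a + b)) * (a + b) powr s" by (rule distrib_right[symmetric])
  also have "a / (a + b) + b / (a + b) = 1" using pos by (simp flip: add_divide_distrib)
  finally show ?thesis by simp
qed

lemma powr_le_affine:
  fixes x s :: real
  assumes "0 \<le> x" "0 \<le> s" "s \<le> 1"
  shows "x powr s \<le> s * x + (1 - s)"
proof (cases "x = 0")
  case False
  then show ?thesis using Youngs_inequality_0[of s "1 - s" x 1] assms by simp
qed (use assms in simp)

text \<open>
  The quantity \<open>a * G * \<tau>\<close> is what the estimating function may lose by moving away from its minimizer.
  Young's inequality splits it into the growth of the function and a power of \<open>a * G\<close>, which the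
  equation for \<open>a\<close> turns into the guaranteed decrease. The constants fit because
  \<open>2 powr (1 / q) \<le> 1 + 1 / q\<close> and \<open>q \<le> p\<close>.
\<close>

lemma estimating_step_scalar:
  fixes a A K q G \<tau> :: real and p :: nat
  assumes q: "1 \<le> q" "q \<le> p" and pos: "0 \<le> a" "0 \<le> A" "0 < K" "0 \<le> G" "0 \<le> \<tau>"
    and a: "a powr (q + 1) = 1 / 2 ^ (3 * p - 1) * K * A powr q"
  shows "a * G * \<tau> \<le> A * (1 / 4 * K powr (1 / q) * G powr ((q + 1) / q)) + 2 / (q + 1) * (\<tau> powr (q + 1) / 2 powr (q + 1))"
proof -
  define r where "r = q + 1"
  have r: "2 \<le> r" "q = r - 1" using q by (simp_all add: r_def)
  have two: "2 powr (1 / q) \<le> r / q"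
  proof -
    have "1 / q * 2 + (1 - 1 / q) = r / q" using q by (simp add: r_def add_divide_distrib)
    then show ?thesis using powr_le_affine[of 2 "1 / q"] q by simp
  qed
  have "(1 / 2 ^ (3 * p - 1)) powr (1 / q) = 2 powr (- (3 * p - 1) / q)"
  proof -
    have "(2::real) ^ (3 * p - 1) = 2 powr (3 * p - 1)"
      using q by (simp add: of_nat_diff flip: powr_realpow)
    then show ?thesis by (simp add: powr_powr flip: powr_minus_divide)
  qed
  also have "\<dots> \<le> 2 powr (1 / q - 3)"
    using q by (intro powr_mono) (auto simp: field_simps)
  also have "\<dots> = 2 powr (1 / q) / 8" by (simp add: powr_diff)
  also have "\<dots> \<le> r / q / 8" using two by simp
  finally have c: "(1 / 2 ^ (3 * p - 1)) powr (1 / q) \<le> r / (8 * q)" by simp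
  have aq: "a powr (r / q) = (1 / 2 ^ (3 * p - 1)) powr (1 / q) * (K powr (1 / q) * A)"
  proof -
    have "a powr (r / q) = (a powr r) powr (1 / q)" by (simp add: powr_powr)
    also have "\<dots> = (1 / 2 ^ (3 * p - 1)) powr (1 / q) * (K powr (1 / q) * A)"
      unfolding r_def a using pos q by (simp add: powr_mult powr_powr powr_divide mult.assoc)
    finally show ?thesis .
  qed
  have "(a * G * 2 powr (q / r)) * (\<tau> * 2 powr (- (q / r)))
     \<le> (a * G * 2 powr (q / r)) powr (r / q) / (r / q) + (\<tau> * 2 powr (- (q / r))) powr r / r"
    using r q pos by (intro Youngs_inequality) (auto simp: field_simps)
  moreover have "(a * G * 2 powr (q / r)) * (\<tau> * 2 powr (- (q / r))) = a * G * \<tau>"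
    by (simp add: powr_minus)
  moreover have "(a * G * 2 powr (q / r)) powr (r / q) = 2 * (a powr (r / q) * G powr (r / q))"
    using r q pos by (simp add: powr_mult powr_powr)
  moreover have "(\<tau> * 2 powr (- (q / r))) powr r / r = 2 / r * (\<tau> powr r / 2 powr r)"
  proof -
    have "(2::real) powr (- q) = 2 / 2 powr r" by (simp add: r powr_diff powr_minus field_simps)
    then show ?thesis using r pos by (simp add: powr_mult powr_powr mult_ac)
  qed
  ultimately have young: "a * G * \<tau> \<le> 2 * (a powr (r / q) * G powr (r / q)) / (r / q) + 2 / r * (\<tau> powr r / 2 powr r)"
    by simp
  have "2 * (a powr (r / q) * G powr (r / q)) / (r / q)
      = 2 * q / r * (1 / 2 ^ (3 * p - 1)) powr (1 / q) * (A * (K powr (1 / q) * G powr (r / q)))"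
    unfolding aq by simp
  also have "\<dots> \<le> 1 / 4 * (A * (K powr (1 / q) * G powr (r / q)))"
  proof (rule mult_right_mono)
    have "2 * q / r * (1 / 2 ^ (3 * p - 1)) powr (1 / q) \<le> 2 * q / r * (r / (8 * q))"
      using c q r by (intro mult_left_mono) auto
    also have "\<dots> = 1 / 4" using q r(1) by simp
    finally show "2 * q / r * (1 / 2 ^ (3 * p - 1)) powr (1 / q) \<le> 1 / 4" .
  qed (use pos in auto)
  finally show ?thesis using young unfolding r_def by simp
qed

text \<open>
  The equation for \<open>a\<close> is a discretization of \<open>A' = K powr (1/r) * A powr (1 - 1/r)\<close>, along which
  \<open>A powr (1/r)\<close> grows linearly; concavity of the root gives the discrete version.
\<close>

lemma scaling_coefficient_growth:
  fixes a A A' K r :: real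
  assumes r: "1 < r" and pos: "0 < a" "0 \<le> A" "0 < K" and A': "A' = A + a"
    and a: "a powr r = K * A' powr (r - 1)"
  shows "A powr (1 / r) + K powr (1 / r) / r \<le> A' powr (1 / r)"
proof -
  have A'pos: "0 < A'" using pos A' by simp
  have "(A / A') powr (1 / r) \<le> 1 / r * (A / A') + (1 - 1 / r)"
    using r pos A'pos by (intro powr_le_affine) auto
  also have "1 / r * (A / A') + (1 - 1 / r) = 1 - a / (r * A')"
  proof -
    have "A / A' = 1 - a / A'" using A'pos by (simp add: A' field_simps)
    then show ?thesis by (simp only: right_diff_distrib) simp
  qed
  finally have "A' powr (1 / r) * (A / A') powr (1 / r) \<le> A' powr (1 / r) * (1 - a / (r * A'))"
    by (rule mult_left_mono) simp
  moreover have "A' powr (1 / r) * (A / A') powr (1 / r) = A powr (1 / r)"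
    using pos A'pos by (simp add: powr_divide)
  moreover have "A' powr (1 / r) * (a / (r * A')) = K powr (1 / r) / r"
  proof -
    have "a = (a powr r) powr (1 / r)" using r pos by (simp add: powr_powr)
    also have "\<dots> = K powr (1 / r) * A' powr ((r - 1) / r)"
      unfolding a using pos A'pos by (simp add: powr_mult powr_powr)
    finally have ae: "a = K powr (1 / r) * A' powr ((r - 1) / r)" .
    have "A' powr (1 / r) * A' powr ((r - 1) / r) = A'"
    proof -
      have "1 / r + (r - 1) / r = 1" using r by (simp flip: add_divide_distrib)
      then show ?thesis using A'pos by (simp flip: powr_add)
    qed
    then have "A' powr (1 / r) * a = K powr (1 / r) * A'"
      by (subst ae) (simp add: mult_ac)
    then show ?thesis using A'pos r by (simp add: field_simps)
  qed
  ultimately show ?thesis by (simp add: right_diff_distrib)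
qed

section \<open>Growth of the estimating functions and convexity\<close>

context euclidean_operator
begin

text \<open>
  For \<open>r = 2\<close> this is the parallelogram law; the power \<open>r / 2\<close> is superadditive and convex.
\<close>

lemma Bnorm_powr_midpoint:
  assumes r: "2 \<le> r"
  shows "Bnorm B ((1 / 2) *\<^sub>R (x + y)) powr r \<le> (Bnorm B x powr r + Bnorm B y powr r) / 2 - Bnorm B (x - y) powr r / 2 powr r"
proof -
  have pw: "Bnorm B z powr r = ip z z powr (r / 2)" for z
    using ip_nonneg[of z] by (simp add: Bnorm_def powr_half_sqrt[symmetric] powr_powr)
  let ?m = "(1 / 2) *\<^sub>R (x + y)" and ?d = "(1 / 2) *\<^sub>R (x - y)"
  have "ip ?m ?m powr (r / 2) + ip ?d ?d powr (r / 2) \<le> (ip ?m ?m + ip ?d ?d) powr (r / 2)"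
    using r by (intro powr_superadditive ip_nonneg) auto
  also have "ip ?m ?m + ip ?d ?d = (ip x x + ip y y) / 2"
    using ip_commute[of x y] by (simp add: ip_simps field_simps)
  also have "\<dots> powr (r / 2) \<le> (ip x x powr (r / 2) + ip y y powr (r / 2)) / 2"
    using r by (intro powr_midpoint_le ip_nonneg) auto
  finally have "Bnorm B ?m powr r + Bnorm B ?d powr r \<le> (Bnorm B x powr r + Bnorm B y powr r) / 2"
    by (simp add: pw)
  moreover have "Bnorm B ?d powr r = Bnorm B (x - y) powr r / 2 powr r"
    by (simp add: Bnorm_scaleR powr_divide)
  ultimately show ?thesis by linarith
qed

text \<open>
  Uniform convexity applied at the midpoint of \<open>x\<close> and the minimizer, where the affine part averages
  exactly. The growth constant obtained this way is smaller than the optimal one but suffices.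
\<close>

lemma minimizer_growth:
  assumes r: "2 \<le> r"
    and psi: "\<And>x. \<psi> x = 1 / r * Bnorm B (x - x0) powr r + blinfun_apply l x + c"
    and min: "\<And>x. \<psi> v \<le> \<psi> x"
  shows "\<psi> v + 2 / r * (Bnorm B (x - v) powr r / 2 powr r) \<le> \<psi> x"
proof -
  let ?m = "(1 / 2) *\<^sub>R (x + v)"
  have m: "?m - x0 = (1 / 2) *\<^sub>R ((x - x0) + (v - x0))"
    by (simp add: algebra_simps) (simp flip: scaleR_left_distrib)
  have "1 / r * Bnorm B (?m - x0) powr r
      \<le> 1 / r * ((Bnorm B (x - x0) powr r + Bnorm B (v - x0) powr r) / 2 - Bnorm B (x - v) powr r / 2 powr r)"
    unfolding m using Bnorm_powr_midpoint[OF r, of "x - x0" "v - x0"] r by (intro mult_left_mono) auto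
  moreover have "blinfun_apply l ?m = (blinfun_apply l x + blinfun_apply l v) / 2"
    by (simp add: ip_simps)
  ultimately have "\<psi> ?m \<le> (\<psi> x + \<psi> v) / 2 - (Bnorm B (x - v) powr r / 2 powr r) / r"
    unfolding psi by (simp add: algebra_simps add_divide_distrib)
  moreover have "\<psi> v \<le> \<psi> ?m" by (rule min)
  moreover have "2 / r * (Bnorm B (x - v) powr r / 2 powr r) = 2 * ((Bnorm B (x - v) powr r / 2 powr r) / r)"
    by simp
  ultimately show ?thesis by argo
qed

end

text \<open>
  Restriction to the line through \<open>y\<close> and \<open>x\<close> reduces this to the tangent inequality on the reals.
\<close>

lemma convex_gradient_inequality:
  fixes f :: "'a::real_normed_vector \<Rightarrow> real"
  assumes convex: "convex_on UNIV f" and f': "(f has_derivative f') (at y)"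
  shows "f y + f' (x - y) \<le> f x"
proof -
  interpret f': bounded_linear f' using f' by (rule has_derivative_bounded_linear)
  let ?\<phi> = "\<lambda>\<tau>. f (y + \<tau> *\<^sub>R (x - y))"
  have "convex_on UNIV ?\<phi>"
  proof (rule convex_onI)
    fix t a b :: real assume t: "0 < t" "t < 1"
    have "y + ((1 - t) *\<^sub>R a + t *\<^sub>R b) *\<^sub>R (x - y) = (1 - t) *\<^sub>R (y + a *\<^sub>R (x - y)) + t *\<^sub>R (y + b *\<^sub>R (x - y))"
      by (simp add: algebra_simps)
    then show "?\<phi> ((1 - t) *\<^sub>R a + t *\<^sub>R b) \<le> (1 - t) * ?\<phi> a + t * ?\<phi> b"
      using convex_onD[OF convex, of t "y + a *\<^sub>R (x - y)" "y + b *\<^sub>R (x - y)"] t by simp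
  qed simp
  moreover have "(?\<phi> has_field_derivative f' (x - y)) (at 0 within UNIV)"
  proof -
    have "(f has_derivative f') (at (y + 0 *\<^sub>R (x - y)))" using f' by simp
    then have "(?\<phi> has_derivative (\<lambda>r. f' (r *\<^sub>R (x - y)))) (at 0)"
      by (rule has_derivative_compose[of "\<lambda>\<tau>. y + \<tau> *\<^sub>R (x - y)", rotated])
         (auto intro!: derivative_eq_intros)
    moreover have "(\<lambda>r. f' (r *\<^sub>R (x - y))) = (*) (f' (x - y))" by (rule ext) (simp add: f'.scaleR)
    ultimately show ?thesis by (simp add: has_field_derivative_def)
  qed
  ultimately have "f' (x - y) * (1 - 0) \<le> ?\<phi> 1 - ?\<phi> 0"
    by (intro convex_on_imp_above_tangent) auto
  then show ?thesis by simp
qed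

section \<open>Runs of the accelerated method\<close>

locale accelerated_run = holder_smooth B f p \<nu> L
  for B :: "'a::euclidean_space \<Rightarrow>\<^sub>L ('a \<Rightarrow>\<^sub>L real)"
    and f :: "'a \<Rightarrow> real" and p :: nat and \<nu> L :: real +
  fixes T :: nat and known :: bool and \<alpha> \<theta> \<epsilon> Ht0 H0 :: real
    and x0 xstar :: 'a and R :: "'a run"
  assumes convex: "convex_on UNIV f"
    and minimizer: "is_arg_min f (\<lambda>_. True) xstar"
    and alpha: "\<alpha> = alpha_exp known \<nu>"
    and params: "Ht0 > 0" "H0 > 0" "\<theta> \<ge> 0" "0 < \<epsilon>" "\<epsilon> < 1"
    and init: "run_init B p \<alpha> x0 Ht0 H0 R"
    and steps: "\<forall>t \<le> T. run_step B f p \<alpha> \<theta> \<epsilon> R t"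
    and large_grad: "\<forall>t \<le> T. \<forall>i \<le> itx R t. \<forall>j \<le> itz R t.
        min (dual_Bnorm B (grad f (xplus R t i))) (dual_Bnorm B (grad f (zplus R t j))) > \<epsilon>"
begin

text \<open>
  The gradient at the end of a step of length \<open>\<rho>\<close> is at most of order \<open>\<rho> powr q\<close>;
  the regularizer has degree \<open>q + 1\<close>.
\<close>

definition q :: real where "q = p + \<alpha> - 1"

definition Ht_max :: real where "Ht_max = max Ht0 (Nt_const known p \<nu> \<theta> L \<epsilon>)"

definition H_max :: real where "H_max = max H0 (N_const known p \<nu> \<theta> L \<epsilon>)"

lemma alpha_range: "0 \<le> \<alpha>" "\<alpha> \<le> 1"
  using alpha nu by (auto simp: alpha_exp_def)

lemma q_range: "1 \<le> q" "p - 1 \<le> q" "q \<le> p" "q + 1 = p + \<alpha>"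
  using alpha_range p by (auto simp: q_def)

lemma minimum: "f xstar \<le> f x"
  using minimizer by (auto simp: is_arg_min_linorder)

lemma Ht_max_pos: "0 < Ht_max" and H_max_pos: "0 < H_max"
  using params by (auto simp: Ht_max_def H_max_def less_max_iff_disj)

text \<open>
  If the inner loop makes at least one rejection, the next value is the last rejected parameter,
  and rejected parameters are below the threshold; otherwise the value is halved.
\<close>

lemma Ht_bounds: "t \<le> Suc T \<Longrightarrow> 0 < Ht R t \<and> Ht R t \<le> Ht_max"
proof (induction t)
  case 0
  then show ?case using init params by (simp add: run_init_def Ht_max_def)
next
  case (Suc t)
  then have st: "run_step B f p \<alpha> \<theta> \<epsilon> R t" and IH: "0 < Ht R t" "Ht R t \<le> Ht_max" using steps by auto
  have next_Ht: "Ht R (Suc t) = 2 powi (int (itx R t) - 1) * Ht R t" using st by (simp add: run_step_def)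
  show ?case
  proof (cases "itx R t")
    case 0
    then show ?thesis using next_Ht IH Ht_max_pos by (simp add: power_int_minus)
  next
    case (Suc i)
    have M: "0 < 2 ^ i * Ht R t" using IH by simp
    have am: "approx_min B f p \<alpha> \<theta> (2 ^ i * Ht R t) (cand_y R t i) (xplus R t i)"
      and nacc: "\<not> accept_x B f p \<alpha> \<epsilon> (2 ^ i * Ht R t) (cand_y R t i) (xplus R t i)"
      using st lessI[of i] less_imp_le[OF lessI[of i]] unfolding run_step_def Suc by blast+
    have "\<not> Nt_const known p \<nu> \<theta> L \<epsilon> \<le> 2 ^ i * Ht R t"
      using accept_x_large[OF M params(3,4)] am nacc unfolding alpha by blast
    moreover have "Ht R (Suc t) = 2 ^ i * Ht R t" using next_Ht Suc by simp
    ultimately show ?thesis using M by (simp add: Ht_max_def)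
  qed
qed

lemma H_bounds: "t \<le> Suc T \<Longrightarrow> 0 < H R t \<and> H R t \<le> H_max"
proof (induction t)
  case 0
  then show ?case using init params by (simp add: run_init_def H_max_def)
next
  case (Suc t)
  then have st: "run_step B f p \<alpha> \<theta> \<epsilon> R t" and IH: "0 < H R t" "H R t \<le> H_max" using steps by auto
  have next_H: "H R (Suc t) = 2 powi (int (itz R t) - 1) * H R t" using st by (simp add: run_step_def)
  show ?case
  proof (cases "itz R t")
    case 0
    then show ?thesis using next_H IH H_max_pos by (simp add: power_int_minus)
  next
    case (Suc j)
    have M: "0 < 2 ^ j * H R t" using IH by simp
    have am: "approx_min B f p \<alpha> \<theta> (2 ^ j * H R t) (zbar R t) (zplus R t j)"
      and nacc: "\<not> accept_z B f p \<alpha> \<epsilon> (2 ^ j * H R t) (zbar R t) (zplus R t j)"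
      using st lessI[of j] less_imp_le[OF lessI[of j]] unfolding run_step_def Suc by blast+
    have "\<not> N_const known p \<nu> \<theta> L \<epsilon> \<le> 2 ^ j * H R t"
      using accept_z_large[OF M params(3,4,5)] am nacc unfolding alpha by blast
    moreover have "H R (Suc t) = 2 ^ j * H R t" using next_H Suc by simp
    ultimately show ?thesis using M by (simp add: H_max_def)
  qed
qed

lemma accepted_Ht:
  assumes "t \<le> T"
  shows "2 ^ itx R t * Ht R t = 2 * Ht R (Suc t)"
proof -
  have "Ht R (Suc t) = 2 powi (int (itx R t) - 1) * Ht R t"
    using steps assms unfolding run_step_def Suc_eq_plus1 by blast
  then show ?thesis by (simp add: power_int_diff)
qed

lemma accepted_H:
  assumes "t \<le> T"
  shows "2 ^ itz R t * H R t = 2 * H R (Suc t)"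
proof -
  have "H R (Suc t) = 2 powi (int (itz R t) - 1) * H R t"
    using steps assms unfolding run_step_def Suc_eq_plus1 by blast
  then show ?thesis by (simp add: power_int_diff)
qed

lemma zs_gradient_large: "t \<le> T \<Longrightarrow> \<epsilon> < dual_Bnorm B (grad f (zs R t))"
  using steps by (auto simp: run_step_def)

lemma x_step_decrease:
  assumes t: "t \<le> T"
  shows "1 / 4 * (fact (p - 1) / (2 * Ht R (Suc t))) powr (1 / q) * dual_Bnorm B (grad f (xs R (Suc t))) powr ((q + 1) / q)
    \<le> blinfun_apply (grad f (xs R (Suc t))) (cand_y R t (itx R t) - xs R (Suc t))"
proof -
  have st: "run_step B f p \<alpha> \<theta> \<epsilon> R t" using steps t by blast
  then have "accept_x B f p \<alpha> \<epsilon> (2 ^ itx R t * Ht R t) (cand_y R t (itx R t)) (xplus R t (itx R t))"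
    and x: "xs R (Suc t) = xplus R t (itx R t)" by (auto simp: run_step_def)
  moreover have "\<epsilon> < dual_Bnorm B (grad f (xplus R t (itx R t)))" using large_grad t by auto
  ultimately show ?thesis using accepted_Ht[OF t] by (simp add: accept_x_def q_def)
qed

lemma z_step_decrease:
  assumes t: "t \<le> T"
  shows "1 / (8 * fact (p + 1) * (2 * H_max) powr (1 / q)) * dual_Bnorm B (grad f (zs R (Suc t))) powr ((q + 1) / q)
    \<le> f (zbar R t) - f (zs R (Suc t))"
proof -
  have st: "run_step B f p \<alpha> \<theta> \<epsilon> R t" using steps t by blast
  then have "accept_z B f p \<alpha> \<epsilon> (2 ^ itz R t * H R t) (zbar R t) (zplus R t (itz R t))"
    and x: "zs R (Suc t) = zplus R t (itz R t)" by (auto simp: run_step_def)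
  moreover have "\<epsilon> < dual_Bnorm B (grad f (zplus R t (itz R t)))" using large_grad t by auto
  ultimately have acc: "1 / (8 * fact (p + 1) * (2 * H R (Suc t)) powr (1 / q)) * dual_Bnorm B (grad f (zs R (Suc t))) powr ((q + 1) / q)
    \<le> f (zbar R t) - f (zs R (Suc t))"
    using accepted_H[OF t] by (simp add: accept_z_def q_def)
  have H: "0 < H R (Suc t)" "H R (Suc t) \<le> H_max" using H_bounds[of "Suc t"] t by auto
  have "(2 * H R (Suc t)) powr (1 / q) \<le> (2 * H_max) powr (1 / q)"
    using H q_range by (intro powr_mono2) auto
  then have "1 / (8 * fact (p + 1) * (2 * H_max) powr (1 / q)) \<le> 1 / (8 * fact (p + 1) * (2 * H R (Suc t)) powr (1 / q))"
    using H H_max_pos by (intro divide_left_mono mult_left_mono mult_pos_pos) auto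
  then show ?thesis using acc mult_right_mono[OF _ powr_ge_zero] order_trans by blast
qed

text \<open>
  The factor \<open>2 ^ (3 * p)\<close> instead of \<open>2 ^ (3 * p - 1)\<close> appears because an accepted parameter is twice
  the next value of \<open>Ht\<close>, hence at most \<open>2 * Ht_max\<close>.
\<close>

lemma As_growth:
  assumes "t \<le> Suc T"
  shows "0 \<le> As R t \<and> t / (q + 1) * (fact (p - 1) / (2 ^ (3 * p) * Ht_max)) powr (1 / (q + 1)) \<le> As R t powr (1 / (q + 1))"
  using assms
proof (induction t)
  case 0
  then show ?case using init by (simp add: run_init_def)
next
  case (Suc t)
  define a where "a = cand_a R t (itx R t)"
  define K where "K = 1 / 2 ^ (3 * p - 1) * (fact (p - 1) / (2 * Ht R (Suc t)))"
  define K0 where "K0 = fact (p - 1) / (2 ^ (3 * p) * Ht_max)"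
  have st: "run_step B f p \<alpha> \<theta> \<epsilon> R t" using steps Suc.prems by simp
  then have a: "0 < a" "a powr (q + 1) = K * (As R t + a) powr q" "As R (Suc t) = As R t + a"
    using accepted_Ht[of t] Suc.prems q_range
    by (auto simp: run_step_def a_def K_def q_def)
  have Ht: "0 < Ht R (Suc t)" "Ht R (Suc t) \<le> Ht_max" using Ht_bounds[of "Suc t"] Suc.prems by auto
  then have K: "0 < K" by (simp add: K_def)
  have pow: "(2::real) ^ (3 * p) = 2 ^ (3 * p - 1) * 2" using p by (simp flip: power_Suc2)
  have "K0 \<le> K"
    unfolding K0_def K_def pow using Ht Ht_max_pos by (simp add: field_simps)
  then have "K0 powr (1 / (q + 1)) \<le> K powr (1 / (q + 1))"
    using q_range Ht_max_pos by (intro powr_mono2) (auto simp: K0_def)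
  then have "K0 powr (1 / (q + 1)) / (q + 1) \<le> K powr (1 / (q + 1)) / (q + 1)"
    using q_range by (intro divide_right_mono) auto
  moreover have "As R t powr (1 / (q + 1)) + K powr (1 / (q + 1)) / (q + 1) \<le> As R (Suc t) powr (1 / (q + 1))"
    using a K Suc q_range(1) by (intro scaling_coefficient_growth[where a = a]) auto
  moreover have "t / (q + 1) * K0 powr (1 / (q + 1)) \<le> As R t powr (1 / (q + 1))"
    using Suc by (simp add: K0_def)
  moreover have "Suc t / (q + 1) * K0 powr (1 / (q + 1)) = t / (q + 1) * K0 powr (1 / (q + 1)) + K0 powr (1 / (q + 1)) / (q + 1)"
    by (simp add: add_divide_distrib distrib_right)
  ultimately show ?case using a Suc by (simp add: K0_def)
qed

lemma psi_form: "t \<le> Suc T \<Longrightarrow>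
   \<exists>l c. \<forall>x. psi R t x = 1 / (q + 1) * Bnorm B (x - x0) powr (q + 1) + blinfun_apply l x + c"
proof (induction t)
  case 0
  have "psi R 0 x = 1 / (q + 1) * Bnorm B (x - x0) powr (q + 1) + blinfun_apply 0 x + 0" for x
    using init by (simp add: run_init_def q_def)
  then show ?case by blast
next
  case (Suc t)
  then obtain l c where lc: "\<And>x. psi R t x = 1 / (q + 1) * Bnorm B (x - x0) powr (q + 1) + blinfun_apply l x + c" by auto
  define a where "a = cand_a R t (itx R t)"
  define g where "g = grad f (xs R (Suc t))"
  have "run_step B f p \<alpha> \<theta> \<epsilon> R t" using steps Suc.prems by simp
  then have "psi R (Suc t) x = psi R t x + a * (f (xs R (Suc t)) + blinfun_apply g (x - xs R (Suc t)))" for x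
    by (simp add: run_step_def a_def g_def)
  then have "psi R (Suc t) x = 1 / (q + 1) * Bnorm B (x - x0) powr (q + 1) + blinfun_apply (l + a *\<^sub>R g) x
      + (c + a * (f (xs R (Suc t)) - blinfun_apply g (xs R (Suc t))))" for x
    unfolding lc by (simp add: ip_simps algebra_simps)
  then show ?case by blast
qed

lemma vs_minimizes_psi:
  assumes "t \<le> Suc T"
  shows "psi R t (vs R t) \<le> psi R t x"
proof (cases t)
  case 0
  then show ?thesis using init q_range by (simp add: run_init_def)
next
  case (Suc t')
  then have "run_step B f p \<alpha> \<theta> \<epsilon> R t'" using steps assms by simp
  then show ?thesis using Suc by (auto simp: run_step_def is_arg_min_linorder)
qed

lemma psi_upper:
  "t \<le> Suc T \<Longrightarrow> psi R t x \<le> As R t * f x + 1 / (q + 1) * Bnorm B (x - x0) powr (q + 1)"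
proof (induction t)
  case 0
  then show ?case using init by (simp add: run_init_def q_def)
next
  case (Suc t)
  define a where "a = cand_a R t (itx R t)"
  have st: "run_step B f p \<alpha> \<theta> \<epsilon> R t" using steps Suc.prems by simp
  then have a: "0 < a" "As R (Suc t) = As R t + a"
      "psi R (Suc t) x = psi R t x + a * (f (xs R (Suc t)) + blinfun_apply (grad f (xs R (Suc t))) (x - xs R (Suc t)))"
    by (auto simp: run_step_def a_def)
  have "a * (f (xs R (Suc t)) + blinfun_apply (grad f (xs R (Suc t))) (x - xs R (Suc t))) \<le> a * f x"
    using a convex_gradient_inequality[OF convex f_has_derivative] by (intro mult_left_mono) auto
  moreover have "psi R t x \<le> As R t * f x + 1 / (q + 1) * Bnorm B (x - x0) powr (q + 1)"
    using Suc by simp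
  ultimately show ?case unfolding a(2,3) distrib_right[of "As R t"] by linarith
qed

text \<open>
  In passing from \<open>t\<close> to \<open>t + 1\<close>, the old bound at \<open>x t\<close> and the new linear term are combined by
  convexity into \<open>(A + a) * f u\<close> plus \<open>(A + a) * \<langle>g, y - u\<rangle> + a * \<langle>g, x - v\<rangle>\<close>, because \<open>y\<close> is the
  corresponding combination of \<open>x t\<close> and \<open>v\<close>. The first product is large by the acceptance test, and
  the growth of the estimating function around \<open>v\<close> compensates the second.
\<close>

lemma estimating_sequence:
  "t \<le> Suc T \<Longrightarrow> As R t * f (xs R t) \<le> psi R t x"
proof (induction t arbitrary: x)
  case 0
  then show ?case using init q_range by (simp add: run_init_def)
next
  case (Suc t)
  define a where "a = cand_a R t (itx R t)"
  define A where "A = As R t"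
  define u where "u = xs R (Suc t)"
  define v where "v = vs R t"
  define y where "y = cand_y R t (itx R t)"
  define g where "g = grad f u"
  define G where "G = dual_Bnorm B g"
  define K where "K = fact (p - 1) / (2 * Ht R (Suc t))"
  have tT: "t \<le> T" "t \<le> Suc T" using Suc.prems by auto
  have st: "run_step B f p \<alpha> \<theta> \<epsilon> R t" using steps tT by simp
  have Ht: "0 < Ht R (Suc t)" using Ht_bounds[of "Suc t"] Suc.prems by auto
  have a: "0 < a" "a powr (q + 1) = 1 / 2 ^ (3 * p - 1) * K * (A + a) powr q" "As R (Suc t) = A + a"
      "psi R (Suc t) x = psi R t x + a * (f u + blinfun_apply g (x - u))"
      "y = (1 - a / (A + a)) *\<^sub>R xs R t + (a / (A + a)) *\<^sub>R v"
    using st accepted_Ht[OF tT(1)]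
    by (auto simp: run_step_def a_def A_def K_def q_def u_def v_def y_def g_def)
  have A: "0 \<le> A" using As_growth[OF tT(2)] by (simp add: A_def)
  obtain l c where "\<And>x. psi R t x = 1 / (q + 1) * Bnorm B (x - x0) powr (q + 1) + blinfun_apply l x + c"
    using psi_form[OF tT(2)] by blast
  then have growth: "psi R t v + 2 / (q + 1) * (Bnorm B (x - v) powr (q + 1) / 2 powr (q + 1)) \<le> psi R t x"
    unfolding v_def using q_range vs_minimizes_psi[OF tT(2)] by (intro minimizer_growth) auto
  have "A * (f u + blinfun_apply g (xs R t - u)) \<le> A * f (xs R t)"
    unfolding g_def using A convex_gradient_inequality[OF convex f_has_derivative] by (intro mult_left_mono) auto
  also have "\<dots> \<le> psi R t v" using Suc.IH[OF tT(2)] by (simp add: A_def)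
  finally have IH: "A * (f u + blinfun_apply g (xs R t - u)) \<le> psi R t v" .
  have "(A + a) * (1 / 4 * K powr (1 / q) * G powr ((q + 1) / q)) \<le> (A + a) * blinfun_apply g (y - u)"
    using x_step_decrease[OF tT(1)] A a(1) by (intro mult_left_mono) (auto simp: K_def G_def g_def u_def y_def)
  moreover have "a * G * Bnorm B (x - v) \<le> (A + a) * (1 / 4 * K powr (1 / q) * G powr ((q + 1) / q))
      + 2 / (q + 1) * (Bnorm B (x - v) powr (q + 1) / 2 powr (q + 1))"
    using q_range a A Ht by (intro estimating_step_scalar[where p = p]) (auto simp: K_def G_def)
  moreover have "- (a * G * Bnorm B (x - v)) \<le> a * blinfun_apply g (x - v)"
  proof -
    have "\<bar>blinfun_apply g (x - v)\<bar> \<le> G * Bnorm B (x - v)" unfolding G_def by (rule dual_Bnorm_apply)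
    then have "a * (- (G * Bnorm B (x - v))) \<le> a * blinfun_apply g (x - v)"
      using a(1) by (intro mult_left_mono) auto
    then show ?thesis by (simp add: mult.assoc)
  qed
  moreover have "(A + a) * blinfun_apply g (y - u) + a * blinfun_apply g (x - v)
      = A * blinfun_apply g (xs R t - u) + a * blinfun_apply g (x - u)"
  proof -
    have "0 < A + a" using A a(1) by simp
    then have "(A + a) *\<^sub>R y = A *\<^sub>R xs R t + a *\<^sub>R v"
      unfolding a(5) by (simp add: scaleR_add_right right_diff_distrib)
    then have "(A + a) * blinfun_apply g y = A * blinfun_apply g (xs R t) + a * blinfun_apply g v"
      by (metis blinfun.add_right blinfun.scaleR_right real_scaleR_def)
    then show ?thesis by (simp add: ip_simps algebra_simps)
  qed
  ultimately have "(A + a) * f u \<le> psi R t x + a * (f u + blinfun_apply g (x - u))"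
    using growth IH unfolding distrib_left[of _ "f u"] distrib_right[of A a "f u"] by linarith
  then show ?case using a by (simp add: u_def)
qed


section \<open>Rates of convergence\<close>

lemma objective_rate:
  assumes t: "0 < t" "t \<le> Suc T"
  shows "f (xs R t) - f xstar
    \<le> 2 ^ (3 * p) * Ht_max * (q + 1) powr q * Bnorm B (x0 - xstar) powr (q + 1) / (fact (p - 1) * t powr (q + 1))"
proof -
  define K0 where "K0 = fact (p - 1) / (2 ^ (3 * p) * Ht_max)"
  define D where "D = Bnorm B (x0 - xstar) powr (q + 1)"
  have K0: "0 < K0" using Ht_max_pos by (simp add: K0_def)
  have r: "1 \<le> q" "0 < q + 1" using q_range(1) by auto
  have A: "0 \<le> As R t" "t / (q + 1) * K0 powr (1 / (q + 1)) \<le> As R t powr (1 / (q + 1))"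
    using As_growth[OF t(2)] by (auto simp: K0_def)
  have "(t / (q + 1) * K0 powr (1 / (q + 1))) powr (q + 1) \<le> (As R t powr (1 / (q + 1))) powr (q + 1)"
    using A r by (intro powr_mono2) auto
  moreover have "(t / (q + 1) * K0 powr (1 / (q + 1))) powr (q + 1) = (t / (q + 1)) powr (q + 1) * K0"
    using powr_mult[of "t / (q + 1)" "K0 powr (1 / (q + 1))" "q + 1"] r K0 by (simp add: powr_powr)
  ultimately have low: "(t / (q + 1)) powr (q + 1) * K0 \<le> As R t"
    using A r by (simp add: powr_powr)
  have pos: "0 < (t / (q + 1)) powr (q + 1) * K0" using t r K0 by simp
  have "As R t * f (xs R t) \<le> As R t * f xstar + 1 / (q + 1) * D"
    using order_trans[OF estimating_sequence[OF t(2)] psi_upper[OF t(2)], of xstar]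
    by (simp add: D_def Bnorm_minus_commute[of xstar])
  then have "As R t * (f (xs R t) - f xstar) \<le> D / (q + 1)" by (simp add: right_diff_distrib)
  moreover have "(t / (q + 1)) powr (q + 1) * K0 * (f (xs R t) - f xstar) \<le> As R t * (f (xs R t) - f xstar)"
    using low minimum by (intro mult_right_mono) auto
  ultimately have "(t / (q + 1)) powr (q + 1) * K0 * (f (xs R t) - f xstar) \<le> D / (q + 1)" by linarith
  then have "f (xs R t) - f xstar \<le> D / (q + 1) / ((t / (q + 1)) powr (q + 1) * K0)"
    unfolding pos_le_divide_eq[OF pos] by (simp only: mult.commute)
  also have "\<dots> = 2 ^ (3 * p) * Ht_max * (q + 1) powr q * D / (fact (p - 1) * t powr (q + 1))"
    using r t Ht_max_pos by (simp add: K0_def powr_divide powr_add mult_ac)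
  finally show ?thesis by (simp add: D_def)
qed

text \<open>
  Only the second half of the run is used: its first point inherits the small objective gap reached by
  the accelerated sequence at time \<open>s + 1\<close>, and this gap pays for \<open>s\<close> further decreases. The powers of
  two add up to \<open>4 * p + 6\<close>: \<open>3 * p\<close> from the objective rate, \<open>4\<close> from the factor \<open>8\<close> of the test and the
  doubling of the accepted parameter, and \<open>p + 2\<close> from writing \<open>s - 1\<close> as \<open>(T - 2) / 2\<close>.
\<close>

lemma gradient_rate:
  assumes T: "T = 2 * s" "1 < s" and g: "0 \<le> g" "\<And>t. t \<le> T \<Longrightarrow> g \<le> dual_Bnorm B (grad f (zs R t))"
  shows "g powr ((q + 1) / q) \<le> 2 ^ (4 * p + 6) * Ht_max * H_max powr (1 / q)
    * Bnorm B (x0 - xstar) powr (q + 1) * ((p + 1) / (real T - 2)) powr (q + 2)"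
proof -
  define D where "D = Bnorm B (x0 - xstar) powr (q + 1)"
  have D: "0 \<le> D" by (simp add: D_def)
  define \<delta> where "\<delta> = 1 / (8 * fact (p + 1) * (2 * H_max) powr (1 / q)) * g powr ((q + 1) / q)"
  note q = q_range
  have zb: "f (zbar R t) \<le> f (zs R t)" "f (zbar R t) \<le> f (xs R (Suc t))" if "t \<le> T" for t
  proof -
    have "is_arg_min f (\<lambda>y. y \<in> {zs R t, xs R (t + 1)}) (zbar R t)"
      using steps that unfolding run_step_def by blast
    then show "f (zbar R t) \<le> f (zs R t)" "f (zbar R t) \<le> f (xs R (Suc t))"
      by (auto simp: is_arg_min_linorder)
  qed
  have dec: "f (zbar R (Suc t)) + \<delta> \<le> f (zbar R t)" if "Suc t \<le> T" for t
  proof -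
    have "\<delta> \<le> 1 / (8 * fact (p + 1) * (2 * H_max) powr (1 / q)) * dual_Bnorm B (grad f (zs R (Suc t))) powr ((q + 1) / q)"
      unfolding \<delta>_def using g that q(1) by (intro mult_left_mono powr_mono2) auto
    also have "\<dots> \<le> f (zbar R t) - f (zs R (Suc t))" using that by (intro z_step_decrease) simp
    finally show ?thesis using zb(1)[OF that] by simp
  qed
  have "f (zbar R (s + k)) + k * \<delta> \<le> f (xs R (Suc s))" if "k \<le> s" for k
    using that
  proof (induction k)
    case 0
    then show ?case using zb(2)[of s] T by simp
  next
    case (Suc k)
    then have "f (zbar R (Suc (s + k))) + \<delta> \<le> f (zbar R (s + k))" using T by (intro dec) simp
    then show ?case using Suc by (simp add: distrib_right)
  qed
  from this[of s] have "s * \<delta> \<le> f (xs R (Suc s)) - f xstar" using minimum[of "zbar R (s + s)"] by simp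
  also have "\<dots> \<le> 2 ^ (3 * p) * Ht_max * (q + 1) powr q * D / (fact (p - 1) * real (Suc s) powr (q + 1))"
    unfolding D_def using T by (intro objective_rate) auto
  also have "\<dots> \<le> 2 ^ (3 * p) * Ht_max * (p + 1) powr q * D / (fact (p - 1) * real (s - 1) powr (q + 1))"
    using q T Ht_max_pos D
    by (intro frac_le mult_left_mono mult_right_mono powr_mono2 mult_nonneg_nonneg mult_pos_pos) auto
  finally have main: "s * \<delta> \<le> 2 ^ (3 * p) * Ht_max * (p + 1) powr q * D / (fact (p - 1) * real (s - 1) powr (q + 1))" .
  have s1: "0 < real (s - 1)" "real (s - 1) \<le> s" using T by auto
  have Mz2: "0 < (2 * H_max) powr (1 / q)" using H_max_pos by simp
  have "real (s - 1) * \<delta> \<le> s * \<delta>" using s1 by (intro mult_right_mono) (auto simp: \<delta>_def)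
  with main have "real (s - 1) * \<delta> \<le> 2 ^ (3 * p) * Ht_max * (p + 1) powr q * D / (fact (p - 1) * real (s - 1) powr (q + 1))"
    by linarith
  then have "8 * fact (p + 1) * (2 * H_max) powr (1 / q) / real (s - 1) * (real (s - 1) * \<delta>)
      \<le> 8 * fact (p + 1) * (2 * H_max) powr (1 / q) / real (s - 1)
        * (2 ^ (3 * p) * Ht_max * (p + 1) powr q * D / (fact (p - 1) * real (s - 1) powr (q + 1)))"
    using s1 by (intro mult_left_mono) auto
  moreover have "8 * fact (p + 1) * (2 * H_max) powr (1 / q) / real (s - 1) * (real (s - 1) * \<delta>) = g powr ((q + 1) / q)"
    using s1 Mz2 by (simp add: \<delta>_def del: fact_Suc)
  ultimately have "g powr ((q + 1) / q) \<le> 8 * fact (p + 1) * (2 * H_max) powr (1 / q) / real (s - 1)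
        * (2 ^ (3 * p) * Ht_max * (p + 1) powr q * D / (fact (p - 1) * real (s - 1) powr (q + 1)))"
    by simp
  also have "\<dots> = 2 powr (1 / q) * (real p * (real p + 1)) * (p + 1) powr q
      * (8 * 2 ^ (3 * p) * Ht_max * H_max powr (1 / q) * D / (real (s - 1) powr (q + 1) * real (s - 1)))"
  proof -
    have "(fact (p + 1) :: real) = p * (p + 1) * fact (p - 1)"
      using p by (simp add: fact_reduce algebra_simps)
    then show ?thesis using H_max_pos by (simp add: powr_mult mult_ac) (simp add: algebra_simps)?
  qed
  also have "\<dots> \<le> 2 * ((real p + 1) * (real p + 1)) * (p + 1) powr q
      * (8 * 2 ^ (3 * p) * Ht_max * H_max powr (1 / q) * D / (real (s - 1) powr (q + 1) * real (s - 1)))"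
  proof (intro mult_right_mono mult_mono)
    show "2 powr (1 / q) \<le> 2" using powr_mono[of "1 / q" 1 2] q by simp
  qed (use Ht_max_pos D in auto)
  also have "\<dots> = 2 ^ (3 * p + 4) * Ht_max * H_max powr (1 / q) * D * ((p + 1) / real (s - 1)) powr (q + 2)"
  proof -
    have e: "x powr (q + 2) = x powr q * x * x" "x powr (q + 2) = x powr (q + 1) * x" if "0 < x" for x :: real
    proof -
      have "x powr q * x powr 1 * x powr 1 = x powr (q + 2)" "x powr (q + 1) * x powr 1 = x powr (q + 2)"
        unfolding powr_add[symmetric] by (simp_all add: add.commute)
      then show "x powr (q + 2) = x powr q * x * x" "x powr (q + 2) = x powr (q + 1) * x"
        using that by simp_all
    qed
    have "((p + 1) / real (s - 1)) powr (q + 2) = (real p + 1) powr (q + 2) / real (s - 1) powr (q + 2)"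
      using s1 by (simp add: powr_divide add.commute)
    also have "\<dots> = (real p + 1) powr q * (real p + 1) * (real p + 1) / (real (s - 1) powr (q + 1) * real (s - 1))"
      using e(1)[of "real p + 1"] e(2)[OF s1(1)] by simp
    finally show ?thesis by (simp add: power_add mult_ac add.commute)
  qed
  also have "((p + 1) / real (s - 1)) powr (q + 2) = 2 powr (q + 2) * ((p + 1) / (real T - 2)) powr (q + 2)"
  proof -
    have "real T - 2 = 2 * real (s - 1)" using T by (simp add: of_nat_diff)
    then have "(p + 1) / real (s - 1) = 2 * ((p + 1) / (real T - 2))" using s1 by (simp add: field_simps)
    moreover have "0 \<le> (p + 1) / (real T - 2)" using T by simp
    ultimately show ?thesis by (simp only: powr_mult)
  qed
  also have "2 ^ (3 * p + 4) * Ht_max * H_max powr (1 / q) * D * (2 powr (q + 2) * ((p + 1) / (real T - 2)) powr (q + 2))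
      \<le> 2 ^ (3 * p + 4) * Ht_max * H_max powr (1 / q) * D * (2 ^ (p + 2) * ((p + 1) / (real T - 2)) powr (q + 2))"
  proof (intro mult_left_mono mult_right_mono)
    have "2 powr (q + 2) \<le> 2 powr real (p + 2)" using q by (intro powr_mono) auto
    also have "\<dots> = 2 ^ (p + 2)" by (subst powr_realpow) auto
    finally show "2 powr (q + 2) \<le> (2 :: real) ^ (p + 2)" .
  qed (use Ht_max_pos D in auto)
  also have "\<dots> = 2 ^ (4 * p + 6) * Ht_max * H_max powr (1 / q) * D * ((p + 1) / (real T - 2)) powr (q + 2)"
  proof -
    have "(2::real) ^ (4 * p + 6) = 2 ^ (3 * p + 4) * 2 ^ (p + 2)"
      unfolding power_add[symmetric] by simp
    then show ?thesis by (simp only: mult_ac)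
  qed
  finally show ?thesis by (simp add: D_def)
qed

text \<open>
  The gradient rate solved for \<open>T\<close>, all gradients at the points of the second sequence being larger
  than \<open>\<epsilon>\<close>.
\<close>

lemma iteration_bound:
  assumes T: "T = 2 * s" "1 < s" and Q: "Ht_max \<le> Q" "H_max \<le> Q"
  shows "real T - 2 < (p + 1) * (2 ^ (4 * p + 6)) powr (1 / (q + 2)) * Q powr ((q + 1) / (q * (q + 2)))
    * Bnorm B (x0 - xstar) powr ((q + 1) / (q + 2)) * \<epsilon> powr (- ((q + 1) / (q * (q + 2))))"
proof -
  define X where "X = (real T - 2) / (p + 1)"
  define N where "N = Bnorm B (x0 - xstar)"
  have X: "0 < X" using T by (simp add: X_def)
  have q: "1 \<le> q" by (rule q_range)
  have Qpos: "0 < Q" using Ht_max_pos Q by simp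
  have N: "0 \<le> N" by (simp add: N_def)
  define W where "W = Ht_max * H_max powr (1 / q)"
  have W: "W \<le> Q powr ((q + 1) / q)"
  proof -
    have "W \<le> Q * Q powr (1 / q)"
      unfolding W_def using Q Ht_max_pos H_max_pos q by (intro mult_mono powr_mono2) auto
    also have "\<dots> = Q powr ((q + 1) / q)"
      using Qpos q by (simp add: add_divide_distrib powr_add)
    finally show ?thesis .
  qed
  define g where "g = Min ((\<lambda>t. dual_Bnorm B (grad f (zs R t))) ` {0..T})"
  have "\<epsilon> < g" unfolding g_def using zs_gradient_large by (subst Min_gr_iff) auto
  then have "\<epsilon> powr ((q + 1) / q) < g powr ((q + 1) / q)"
    using params q by (intro powr_less_mono2) auto
  also have "\<dots> \<le> 2 ^ (4 * p + 6) * Ht_max * H_max powr (1 / q) * N powr (q + 1) * ((p + 1) / (real T - 2)) powr (q + 2)"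
    unfolding N_def using \<open>\<epsilon> < g\<close> params by (intro gradient_rate[OF T]) (auto simp: g_def)
  also have "((p + 1) / (real T - 2)) powr (q + 2) = 1 / X powr (q + 2)"
    using T by (simp add: X_def powr_divide)
  finally have "\<epsilon> powr ((q + 1) / q) * X powr (q + 2) < 2 ^ (4 * p + 6) * W * N powr (q + 1)"
    using X by (simp add: W_def field_simps)
  also have "\<dots> \<le> 2 ^ (4 * p + 6) * Q powr ((q + 1) / q) * N powr (q + 1)"
    using W by (intro mult_left_mono mult_right_mono) auto
  finally have "X powr (q + 2) < 2 ^ (4 * p + 6) * Q powr ((q + 1) / q) * N powr (q + 1) * \<epsilon> powr (- ((q + 1) / q))"
    using params by (simp add: powr_minus field_simps)
  then have "(X powr (q + 2)) powr (1 / (q + 2))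
      < (2 ^ (4 * p + 6) * Q powr ((q + 1) / q) * N powr (q + 1) * \<epsilon> powr (- ((q + 1) / q))) powr (1 / (q + 2))"
    using X q by (intro powr_less_mono2) auto
  then have "X < (2 ^ (4 * p + 6)) powr (1 / (q + 2)) * Q powr ((q + 1) / (q * (q + 2)))
      * N powr ((q + 1) / (q + 2)) * \<epsilon> powr (- ((q + 1) / (q * (q + 2))))"
    using X q Qpos N params by (simp add: powr_mult powr_powr)
  then have "(p + 1) * X < (p + 1) * ((2 ^ (4 * p + 6)) powr (1 / (q + 2)) * Q powr ((q + 1) / (q * (q + 2)))
      * N powr ((q + 1) / (q + 2)) * \<epsilon> powr (- ((q + 1) / (q * (q + 2)))))"
    by (intro mult_strict_left_mono) auto
  moreover have "(p + 1) * X = real T - 2" by (simp add: X_def)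
  ultimately show ?thesis by (simp only: N_def mult.assoc)
qed


section \<open>Numbers of iterations\<close>

text \<open>
  The exponent of \<open>Q\<close> in the general bound is at most \<open>1\<close>, and \<open>Q \<ge> 1\<close>.
\<close>

lemma iterations_known:
  assumes T: "T = 2 * s" "1 < s" and known: "known"
  shows "real T \<le> 2 + 2 ^ (4 * p + 6) * (p + 1)
               * Max {1, Ht0, H0, 3 * p * (L + \<theta> * fact (p - 1))}
               * Bnorm B (x0 - xstar) powr ((p + \<nu>) / (p + \<nu> + 1))
               * \<epsilon> powr (- ((p + \<nu>) / ((p + \<nu> - 1) * (p + \<nu> + 1))))"
proof -
  define Q where "Q = Max {1, Ht0, H0, 3 * p * (L + \<theta> * fact (p - 1))}"
  define Z where "Z = Bnorm B (x0 - xstar) powr ((q + 1) / (q + 2)) * \<epsilon> powr (- ((q + 1) / (q * (q + 2))))"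
  have Qge: "1 \<le> Q" "Ht0 \<le> Q" "H0 \<le> Q" "3 * p * (L + \<theta> * fact (p - 1)) \<le> Q"
    by (simp_all add: Q_def)
  have S: "0 \<le> L + \<theta> * fact (p - 1)" "0 \<le> L" "0 \<le> \<theta> * fact (p - 1)" using Holder_const_nonneg params by auto
  have al: "\<alpha> = \<nu>" using alpha known by (simp add: alpha_exp_def)
  have q: "1 \<le> q" "q \<le> p" "p + \<nu> = q + 1" using q_range al by auto
  have "q * (L + \<theta> * fact (p - 1)) \<le> 3 * p * (L + \<theta> * fact (p - 1))"
    using q S by (intro mult_right_mono) auto
  then have Ht_max: "Ht_max \<le> Q"
    using Qge known q unfolding Ht_max_def Nt_const_def by simp
  have "3 * (L + \<theta> * fact (p - 1)) \<le> 3 * p * (L + \<theta> * fact (p - 1))"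
    using p S by (intro mult_right_mono) auto
  then have H_max: "H_max \<le> Q"
    using Qge known S unfolding H_max_def N_const_def by simp
  have "real T - 2 < (real p + 1) * (2 ^ (4 * p + 6)) powr (1 / (q + 2)) * Q powr ((q + 1) / (q * (q + 2))) * Z"
    using iteration_bound[OF T Ht_max H_max] by (simp add: Z_def mult.assoc add.commute)
  also have "\<dots> \<le> (real p + 1) * 2 ^ (4 * p + 6) * Q * Z"
  proof (intro mult_right_mono mult_mono)
    show "(2 ^ (4 * p + 6)) powr (1 / (q + 2)) \<le> (2 :: real) ^ (4 * p + 6)"
      using powr_mono[of "1 / (q + 2)" 1 "2 ^ (4 * p + 6)"] q by simp
    have "1 * (q + 1) \<le> q * (q + 2)" using q by (intro mult_mono) auto
    then have "(q + 1) / (q * (q + 2)) \<le> 1" using q by (simp add: divide_le_eq)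
    then show "Q powr ((q + 1) / (q * (q + 2))) \<le> Q"
      using powr_mono[of "(q + 1) / (q * (q + 2))" 1 Q] Qge by simp
  qed (use Qge in \<open>auto simp: Z_def\<close>)
  finally show ?thesis
    unfolding Q_def[symmetric] Z_def q(3) by (simp add: algebra_simps)
qed

text \<open>
  Both \<open>Ht_max\<close> and \<open>H_max\<close> are at most \<open>Q * \<epsilon> powr (- w)\<close>. The additional power of \<open>\<epsilon>\<close> merges with the one of
  the general bound because \<open>1 + w = p / (p + \<nu> - 1)\<close>. The exponents of \<open>Q\<close> and of \<open>2 ^ (4 * p + 6)\<close> are
  at most \<open>1 / 2\<close>.
\<close>

lemma iterations_unknown:
  assumes T: "T = 2 * s" "1 < s" and known: "\<not> known"
  shows "real T < 2 + 2 ^ (2 * p + 3) * (p + 1)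
               * Max {1, Ht0, H0, 4 * ((4 * L) powr (p / (p + \<nu> - 1)) + \<theta> * fact (p - 1))} powr (1 / 2)
               * Bnorm B (x0 - xstar) powr ((p + 1) / (p + 2))
               * \<epsilon> powr (- ((p + 1) / ((p + \<nu> - 1) * (p + 2))))"
proof -
  define r where "r = p + \<nu> - 1"
  define w where "w = (1 - \<nu>) / r"
  define E where "E = \<epsilon> powr (- w)"
  define c where "c = (4 * L) powr (p / r)"
  define Q where "Q = Max {1, Ht0, H0, 4 * (c + \<theta> * fact (p - 1))}"
  define n where "n = Bnorm B (x0 - xstar) powr ((p + 1) / (p + 2))"
  have Qge: "1 \<le> Q" "Ht0 \<le> Q" "H0 \<le> Q" "4 * (c + \<theta> * fact (p - 1)) \<le> Q"
    by (simp_all add: Q_def)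
  have al: "\<alpha> = 1" using alpha known by (simp add: alpha_exp_def)
  then have q: "q = p" unfolding q_def by simp
  have r: "1 \<le> r" using p nu by (simp add: r_def)
  have w: "0 \<le> w" "w \<le> 1" using nu r p by (simp_all add: w_def r_def)
  have E: "1 \<le> E" using powr_mono'[of "- w" 0 \<epsilon>] params w by (simp add: E_def)
  have c0: "0 \<le> c" by (simp add: c_def)
  define F where "F = \<theta> * fact (p - 1)"
  have F: "0 \<le> F" "\<theta> \<le> F" "4 * (c + F) \<le> Q" using params le_mult_fact_pred[OF params(3)] Qge(4) by (simp_all add: F_def)
  have "F \<le> 4 * (c + F)" using F(1) c0 by simp
  then have thQ: "\<theta> \<le> Q" using F(2,3) by simp
  have QE: "Q \<le> Q * E" using mult_left_mono[OF E, of Q] Qge by simp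
  have four: "4 powr w \<le> (4 :: real)" using powr_mono[of w 1 4] w by simp
  have fe: "(4 / \<epsilon>) powr w = 4 powr w * E"
  proof -
    have "E = 1 / \<epsilon> powr w" unfolding E_def by (rule powr_minus_divide)
    then show ?thesis using params by (simp add: powr_divide)
  qed
  have "c * (4 / \<epsilon>) powr w \<le> Q * E"
  proof -
    have "c * (4 powr w * E) \<le> c * (4 * E)" using c0 four E by (intro mult_left_mono mult_right_mono) auto
    also have "\<dots> = 4 * c * E" by simp
    also have "\<dots> \<le> Q * E" using F E by (intro mult_right_mono) auto
    finally show ?thesis by (simp add: fe)
  qed
  moreover have "Ht0 \<le> Q * E" by (rule order_trans[OF Qge(2) QE])
  moreover have "4 * \<theta> * fact (p - 1) \<le> Q * E"
  proof -
    have "4 * \<theta> * fact (p - 1) \<le> 4 * (c + \<theta> * fact (p - 1))" using c0 by simp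
    also note Qge(4)
    also note QE
    finally show ?thesis .
  qed
  ultimately have Ht_max: "Ht_max \<le> Q * E"
    using known
    unfolding Ht_max_def Nt_const_def r_def[symmetric] w_def[symmetric] c_def[symmetric] by simp
  have "max \<theta> ((3 * L / 2) powr (p / r) * 4 powr w) * E \<le> Q * E"
  proof (intro mult_right_mono max.boundedI)
    show "\<theta> \<le> Q" by (rule thQ)
    have "(3 * L / 2) powr (p / r) \<le> c"
      unfolding c_def using Holder_const_nonneg r p by (intro powr_mono2) auto
    then have "(3 * L / 2) powr (p / r) * 4 powr w \<le> c * 4" using four c0 by (intro mult_mono) auto
    then show "(3 * L / 2) powr (p / r) * 4 powr w \<le> Q" using F by simp
  qed (use E in simp)
  then have H_max: "H_max \<le> Q * E"
    using order_trans[OF Qge(3) QE] known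
    unfolding H_max_def N_const_def r_def[symmetric] w_def[symmetric] E_def[symmetric] by simp
  define m where "m = (real p + 1) / (p * (real p + 2))"
  have pp: "2 \<le> real p" using p by simp
  have "2 * (real p + 1) \<le> p * (real p + 2)"
    using mult_mono[of 2 "real p" "real p + 1" "real p + 2"] pp by simp
  then have m: "m \<le> 1 / 2" "0 \<le> m" using pp by (simp_all add: m_def field_simps)
  have "real T - 2 < (real p + 1) * (2 ^ (4 * p + 6)) powr (1 / (real p + 2)) * (Q * E) powr m * n * \<epsilon> powr (- m)"
    using iteration_bound[OF T Ht_max H_max] unfolding q m_def n_def by (simp add: add.commute)
  also have "\<dots> = (real p + 1) * (2 ^ (4 * p + 6)) powr (1 / (real p + 2)) * Q powr m * n * (E powr m * \<epsilon> powr (- m))"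
    using Qge E by (simp add: powr_mult)
  also have "E powr m * \<epsilon> powr (- m) = \<epsilon> powr (- ((real p + 1) / (r * (real p + 2))))"
  proof -
    have "w * m + m = (w + 1) * m" by (simp add: distrib_right)
    also have "w + 1 = p / r" using r by (simp add: w_def r_def field_simps)
    also have "p / r * m = (real p + 1) / (r * (real p + 2))" using p by (simp add: m_def)
    finally have "- w * m + - m = - ((real p + 1) / (r * (real p + 2)))" by simp
    then show ?thesis unfolding E_def powr_powr powr_add[symmetric] by simp
  qed
  also have "(real p + 1) * (2 ^ (4 * p + 6)) powr (1 / (real p + 2)) * Q powr m * n * \<epsilon> powr (- ((real p + 1) / (r * (real p + 2))))
     \<le> (real p + 1) * 2 ^ (2 * p + 3) * Q powr (1 / 2) * n * \<epsilon> powr (- ((real p + 1) / (r * (real p + 2))))"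
  proof (intro mult_right_mono mult_mono)
    have "(2 ^ (4 * p + 6)) powr (1 / (real p + 2)) \<le> (2 ^ (4 * p + 6) :: real) powr (1 / 2)"
      using p by (intro powr_mono divide_left_mono) auto
    also have "\<dots> = 2 ^ (2 * p + 3)"
    proof -
      have "(2 ^ (4 * p + 6) :: real) = (2 ^ (2 * p + 3)) powr 2"
        by (simp flip: power_mult)
      then show ?thesis unfolding powr_powr by simp
    qed
    finally show "(2 ^ (4 * p + 6)) powr (1 / (real p + 2)) \<le> (2 :: real) ^ (2 * p + 3)" .
    show "Q powr m \<le> Q powr (1 / 2)" using m Qge by (intro powr_mono) auto
  qed (auto simp: n_def)
  finally show ?thesis
    unfolding r_def[symmetric] c_def[symmetric] Q_def[symmetric] n_def by (simp add: algebra_simps)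
qed

lemma gradient_bound:
  assumes T: "T = 2 * s" "1 < s"
  shows "Min ((\<lambda>t. dual_Bnorm B (grad f (zs R t))) ` {0..T})
           \<le> C_const known p \<nu> \<theta> L \<epsilon> Ht0 H0 * Bnorm B (x0 - xstar) powr (p + \<alpha> - 1)
               * ((p + 1) / (real T - 2)) powr ((p + \<alpha> - 1) * (p + \<alpha> + 1) / (p + \<alpha>))"
proof -
  define g where "g = Min ((\<lambda>t. dual_Bnorm B (grad f (zs R t))) ` {0..T})"
  define W where "W = 2 ^ (4 * p + 6) * Ht_max * H_max powr (1 / q)"
  have q: "1 \<le> q" "q + 1 = p + \<alpha>" "q = p + \<alpha> - 1" "q + 2 = p + \<alpha> + 1" using q_range by auto
  have W: "0 \<le> W" using Ht_max_pos by (simp add: W_def)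
  have g0: "0 \<le> g" unfolding g_def by (subst Min_ge_iff) auto
  have "g powr ((q + 1) / q) \<le> W * Bnorm B (x0 - xstar) powr (q + 1) * ((p + 1) / (real T - 2)) powr (q + 2)"
    unfolding W_def by (rule gradient_rate[OF T g0]) (auto simp: g_def)
  then have "(g powr ((q + 1) / q)) powr (q / (q + 1))
      \<le> (W * Bnorm B (x0 - xstar) powr (q + 1) * ((p + 1) / (real T - 2)) powr (q + 2)) powr (q / (q + 1))"
    using q(1) by (intro powr_mono2) auto
  then have "g \<le> W powr (q / (q + 1)) * Bnorm B (x0 - xstar) powr q * ((p + 1) / (real T - 2)) powr (q * (q + 2) / (q + 1))"
    using g0 W T q(1) by (simp add: powr_mult powr_powr mult.commute[of "q + 2"])
  moreover have "C_const known p \<nu> \<theta> L \<epsilon> Ht0 H0 = W powr (q / (q + 1))"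
    unfolding C_const_def Let_def W_def Ht_max_def H_max_def q_def alpha[symmetric] by simp
  ultimately show ?thesis
    unfolding g_def q(3)[symmetric] q(4)[symmetric] q(2)[symmetric] by (simp add: add.commute)
qed

end

theorem theorem4p2:
  fixes B :: "'a::euclidean_space \<Rightarrow>\<^sub>L ('a \<Rightarrow>\<^sub>L real)"
    and f :: "'a \<Rightarrow> real"
    and p T s :: nat
    and known :: bool
    and \<nu> \<alpha> L \<theta> \<epsilon> Ht0 H0 :: real
    and x0 xstar :: 'a
    and R :: "'a run"
  assumes B: "self_adjoint_pos_def B"
    and p: "p \<ge> 2"
    and convex: "convex_on UNIV f"
    and diff: "times_differentiable p f"
    and minimizer: "is_arg_min f (\<lambda>_. True) xstar"
    and nu: "0 \<le> \<nu>" "\<nu> \<le> 1"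
    and Holder: "Holder_const B f p \<nu> < \<infinity>"
    and L: "L = real_of_ereal (Holder_const B f p \<nu>)"
    and alpha: "\<alpha> = alpha_exp known \<nu>"
    and params: "Ht0 > 0" "H0 > 0" "\<theta> \<ge> 0" "0 < \<epsilon>" "\<epsilon> < 1"
    and init: "run_init B p \<alpha> x0 Ht0 H0 R"
    and steps: "\<forall>t \<le> T. run_step B f p \<alpha> \<theta> \<epsilon> R t"
    and large_grad: "\<forall>t \<le> T. \<forall>i \<le> itx R t. \<forall>j \<le> itz R t.
        min (dual_Bnorm B (grad f (xplus R t i))) (dual_Bnorm B (grad f (zplus R t j))) > \<epsilon>"
    and T: "T = 2 * s" "s > 1"
  shows "Min ((\<lambda>t. dual_Bnorm B (grad f (zs R t))) ` {0..T})
           \<le> C_const known p \<nu> \<theta> L \<epsilon> Ht0 H0 * Bnorm B (x0 - xstar) powr (p + \<alpha> - 1)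
               * ((p + 1) / (real T - 2)) powr ((p + \<alpha> - 1) * (p + \<alpha> + 1) / (p + \<alpha>))
         \<and> (known \<longrightarrow>
           real T \<le> 2 + 2 ^ (4 * p + 6) * (p + 1)
               * Max {1, Ht0, H0, 3 * p * (L + \<theta> * fact (p - 1))}
               * Bnorm B (x0 - xstar) powr ((p + \<nu>) / (p + \<nu> + 1))
               * \<epsilon> powr (- ((p + \<nu>) / ((p + \<nu> - 1) * (p + \<nu> + 1)))))
         \<and> (\<not> known \<longrightarrow>
           real T < 2 + 2 ^ (2 * p + 3) * (p + 1)
               * Max {1, Ht0, H0, 4 * ((4 * L) powr (p / (p + \<nu> - 1)) + \<theta> * fact (p - 1))} powr (1 / 2)
               * Bnorm B (x0 - xstar) powr ((p + 1) / (p + 2))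
               * \<epsilon> powr (- ((p + 1) / ((p + \<nu> - 1) * (p + 2)))))"
proof -
  interpret accelerated_run B f p \<nu> L T known \<alpha> \<theta> \<epsilon> Ht0 H0 x0 xstar R
    by unfold_locales (fact assms)+
  show ?thesis
    using gradient_bound[OF T] iterations_known[OF T] iterations_unknown[OF T] by blast
qed

end
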